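(* Let $R=k[x_1,\ldots,x_d]$ where $k$ is an algebraically closed field, and let $n$ be a positive integer. For every $\mathbf{G}_1,\ldots,\mathbf{G}_m,\mathbf{F}\in M_n(R)$ the following are equivalent. (1) $\mathbf{F}$ belongs to the smallest semiprime left ideal of $M_n(R)$ that contains $\mathbf{G}_1,\ldots,\mathbf{G}_m$. (2) For every $a\in k^d$ and every $\mathbf{v}\in k^n$ such that $\mathbf{G}_1(a)\mathbf{v}=\ldots=\mathbf{G}_m(a)\mathbf{v}=0$ we have $\mathbf{F}(a)\mathbf{v}=0$.
   Context: $M_n(R)$ is the ring of $n\times n$ matrices over $R$. A left ideal $I$ of $S=M_n(R)$ is semiprime if for all $x\in S$, $xSx\subseteq I$ implies $x\in I$ (it is not required to be proper). "Smallest" is with respect to inclusion. For $\mathbf{G}\in M_n(R)$ and $a\in k^d$, $\mathbf{G}(a)\in M_n(k)$ is the matrix obtained by evaluating all entries of $\mathbf{G}$ at $a$; vectors $\mathbf{v}\in k^n$ are viewed as columns in the product $\mathbf{G}(a)\mathbf{v}$. *)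

theory Defs
  imports
    "HOL-Library.Poly_Mapping"
    "HOL-Computational_Algebra.Polynomial"
    "HOL-Algebra.Ideal"
    "Jordan_Normal_Form.Matrix"
begin

text \<open>
  Finitely supported functions under convolution are polynomials in the variables
  \<open>x\<^sub>0, x\<^sub>1, \<dots>\<close>; the ring of polynomials in \<open>d\<close> variables is the subring in which only
  \<open>x\<^sub>i\<close> with \<open>i < d\<close> occur. This includes \<open>d = 0\<close>.
\<close>

type_synonym 'k mpoly = "(nat \<Rightarrow>\<^sub>0 nat) \<Rightarrow>\<^sub>0 'k"

definition mpolys :: "nat \<Rightarrow> 'k::comm_ring_1 mpoly set" where
  "mpolys d = {p. \<forall>m \<in> Poly_Mapping.keys p. Poly_Mapping.keys m \<subseteq> {..<d}}"

definition eval_mpoly :: "'k::comm_ring_1 vec \<Rightarrow> 'k mpoly \<Rightarrow> 'k" where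
  "eval_mpoly a p =
    (\<Sum>m \<in> Poly_Mapping.keys p. Poly_Mapping.lookup p m *
      (\<Prod>i \<in> Poly_Mapping.keys m. (a $ i) ^ Poly_Mapping.lookup m i))"

definition mpoly_mats :: "nat \<Rightarrow> nat \<Rightarrow> 'k::comm_ring_1 mpoly mat set" where
  "mpoly_mats d n = {A \<in> carrier_mat n n. \<forall>i<n. \<forall>j<n. A $$ (i, j) \<in> mpolys d}"

definition mpoly_mat_ring :: "nat \<Rightarrow> nat \<Rightarrow> 'k::comm_ring_1 mpoly mat ring" where
  "mpoly_mat_ring d n = (ring_mat TYPE('k mpoly) n ()) \<lparr>carrier := mpoly_mats d n\<rparr>"

definition eval_mat :: "'k::comm_ring_1 vec \<Rightarrow> 'k mpoly mat \<Rightarrow> 'k mat" where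
  "eval_mat a A = map_mat (eval_mpoly a) A"

locale left_ideal = additive_subgroup I S + ring S for I and S (structure) +
  assumes l_closed: "\<lbrakk>a \<in> I; x \<in> carrier S\<rbrakk> \<Longrightarrow> x \<otimes> a \<in> I"

locale semiprime_left_ideal = left_ideal +
  assumes semiprime:
    "\<lbrakk>x \<in> carrier S; \<forall>s \<in> carrier S. x \<otimes> s \<otimes> x \<in> I\<rbrakk> \<Longrightarrow> x \<in> I"

definition semiprime_left_ideal_gen :: "('a, 'b) ring_scheme \<Rightarrow> 'a set \<Rightarrow> 'a set" where
  "semiprime_left_ideal_gen S X = (LEAST I. semiprime_left_ideal I S \<and> X \<subseteq> I)"

text \<open>The smallest semiprime left ideal over \<open>X\<close> exists, so the \<open>LEAST\<close> above is meaningful.\<close>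

lemma semiprime_left_ideal_carrier:
  assumes "ring S"
  shows "semiprime_left_ideal (carrier S) S"
proof -
  interpret ring S by fact
  show ?thesis
    by (intro semiprime_left_ideal.intro left_ideal.intro left_ideal_axioms.intro
        semiprime_left_ideal_axioms.intro additive_subgroupI add.subgroup_self ring_axioms) auto
qed

lemma semiprime_left_ideal_Inter:
  assumes "ring S" "\<A> \<noteq> {}" "\<And>I. I \<in> \<A> \<Longrightarrow> semiprime_left_ideal I S"
  shows "semiprime_left_ideal (\<Inter>\<A>) S"
proof -
  interpret ring S by fact
  have left: "left_ideal I S" if "I \<in> \<A>" for I
    using assms(3)[OF that] by (rule semiprime_left_ideal.axioms)
  have sub: "subgroup I (add_monoid S)" if "I \<in> \<A>" for I
    using left_ideal.axioms(1)[OF left[OF that]] by (rule additive_subgroup.a_subgroup)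
  have "subgroup (\<Inter>\<A>) (add_monoid S)"
    using add.subgroups_Inter[of \<A>] sub assms(2) by blast
  moreover have "x \<otimes>\<^bsub>S\<^esub> a \<in> \<Inter>\<A>" if a: "a \<in> \<Inter>\<A>" and x: "x \<in> carrier S" for a x
  proof
    fix I assume "I \<in> \<A>"
    then show "x \<otimes>\<^bsub>S\<^esub> a \<in> I"
      using left_ideal.l_closed[OF left] a x by blast
  qed
  moreover have "x \<in> \<Inter>\<A>"
    if x: "x \<in> carrier S" "\<forall>s \<in> carrier S. x \<otimes>\<^bsub>S\<^esub> s \<otimes>\<^bsub>S\<^esub> x \<in> \<Inter>\<A>" for x
  proof
    fix I assume "I \<in> \<A>"
    then show "x \<in> I"
      using semiprime_left_ideal.semiprime[OF assms(3)] x by blast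
  qed
  ultimately show ?thesis
    by (intro semiprime_left_ideal.intro left_ideal.intro left_ideal_axioms.intro
        semiprime_left_ideal_axioms.intro additive_subgroupI ring_axioms)
qed

lemma semiprime_left_ideal_gen_eq_Inter:
  assumes "ring S" "X \<subseteq> carrier S"
  shows "semiprime_left_ideal_gen S X = \<Inter>{I. semiprime_left_ideal I S \<and> X \<subseteq> I}"
  unfolding semiprime_left_ideal_gen_def
proof (rule Least_equality)
  have "semiprime_left_ideal (\<Inter>{I. semiprime_left_ideal I S \<and> X \<subseteq> I}) S"
    by (rule semiprime_left_ideal_Inter)
      (use assms semiprime_left_ideal_carrier[OF assms(1)] in auto)
  then show "semiprime_left_ideal (\<Inter>{I. semiprime_left_ideal I S \<and> X \<subseteq> I}) S \<and>
      X \<subseteq> \<Inter>{I. semiprime_left_ideal I S \<and> X \<subseteq> I}"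
    by blast
qed blast

lemma mpolys_0 [simp]: "0 \<in> mpolys d"
  by (simp add: mpolys_def)

lemma mpolys_1 [simp]: "1 \<in> mpolys d"
  by (simp add: mpolys_def)

lemma mpolys_add: "p \<in> mpolys d \<Longrightarrow> q \<in> mpolys d \<Longrightarrow> p + q \<in> mpolys d"
  using Poly_Mapping.keys_add[of p q] by (auto simp: mpolys_def)

lemma mpolys_uminus: "p \<in> mpolys d \<Longrightarrow> - p \<in> mpolys d"
  by (simp add: mpolys_def)

lemma mpolys_mult:
  assumes "p \<in> mpolys d" "q \<in> mpolys d"
  shows "p * q \<in> mpolys d"
  unfolding mpolys_def
proof (intro CollectI ballI)
  fix m assume "m \<in> Poly_Mapping.keys (p * q)"
  then obtain a b where "a \<in> Poly_Mapping.keys p" "b \<in> Poly_Mapping.keys q" "m = a + b"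
    using keys_mult[of p q] by blast
  then show "Poly_Mapping.keys m \<subseteq> {..<d}"
    using assms Poly_Mapping.keys_add[of a b] unfolding mpolys_def by blast
qed

lemma mpolys_sum: "(\<And>i. i \<in> A \<Longrightarrow> f i \<in> mpolys d) \<Longrightarrow> sum f A \<in> mpolys d"
  by (induction A rule: infinite_finite_induct) (auto intro: mpolys_add)

lemma ring_mpoly_mat_ring: "ring (mpoly_mat_ring d n :: 'k::comm_ring_1 mpoly mat ring)"
proof -
  let ?M = "mpoly_mats d n :: 'k mpoly mat set"
  have carrier: "A \<in> carrier_mat n n" if "A \<in> ?M" for A
    using that by (simp add: mpoly_mats_def)
  have add: "A + B \<in> ?M" if "A \<in> ?M" "B \<in> ?M" for A B
    using that by (auto simp: mpoly_mats_def intro!: mpolys_add)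
  have mult: "A * B \<in> ?M" if "A \<in> ?M" "B \<in> ?M" for A B
    using that by (auto simp: mpoly_mats_def scalar_prod_def intro!: mpolys_sum mpolys_mult)
  have neg: "- A \<in> ?M" if "A \<in> ?M" for A
    using that by (auto simp: mpoly_mats_def intro!: mpolys_uminus)
  have zero: "0\<^sub>m n n \<in> ?M" and one: "1\<^sub>m n \<in> ?M"
    by (auto simp: mpoly_mats_def one_mat_def)
  have inv: "\<exists>B \<in> ?M. B + A = 0\<^sub>m n n" if "A \<in> ?M" for A
    using neg[OF that] carrier[OF that] by (intro bexI[of _ "- A"]) auto
  have ops: "carrier (mpoly_mat_ring d n) = ?M" "mult (mpoly_mat_ring d n :: 'k mpoly mat ring) = (*)"
    "add (mpoly_mat_ring d n :: 'k mpoly mat ring) = (+)"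
    "one (mpoly_mat_ring d n :: 'k mpoly mat ring) = 1\<^sub>m n"
    "zero (mpoly_mat_ring d n :: 'k mpoly mat ring) = 0\<^sub>m n n"
    by (simp_all add: mpoly_mat_ring_def ring_mat_def)
  show ?thesis
  proof (rule ringI)
    show "abelian_group (mpoly_mat_ring d n :: 'k mpoly mat ring)"
      by (rule abelian_groupI; unfold ops)
        (auto simp: add zero inv dest!: carrier intro: assoc_add_mat comm_add_mat)
    show "monoid (mpoly_mat_ring d n :: 'k mpoly mat ring)"
      by (rule monoidI; unfold ops)
        (use carrier in \<open>simp_all add: mult one assoc_mult_mat[of _ n n _ n _ n]
          left_mult_one_mat[of _ n n] right_mult_one_mat[of _ n n]\<close>)
  qed (auto simp: ops dest!: carrier intro: add_mult_distrib_mat mult_add_distrib_mat)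
qed

end

theory Submission
  imports Defs "Jordan_Normal_Form.Char_Poly"
begin

text \<open>
  Write \<open>R\<close> for the polynomial ring \<open>k[x\<^sub>0, \<dots>, x\<^sub>d\<^sub>-\<^sub>1]\<close>. That members of the smallest semiprime
  left ideal satisfy the vanishing condition is seen at one point and one vector at a time: the
  matrices \<open>B\<close> with \<open>B(a)v = 0\<close> form a semiprime left ideal, because if \<open>w = x(a)v\<close> had a nonzero entry, sandwiching the elementary matrices between two copies of
  \<open>x\<close> would force the corresponding row of \<open>x(a)\<close>, and with it that entry, to be \<open>0\<close>
  (\<open>semiprime_left_ideal_killing_vector\<close>).

  For the converse, a semiprime left ideal \<open>I\<close> is replaced by the \<open>R\<close>-module \<open>N\<close> of the rows that may
  occur in its elements. Semiprimeness of \<open>I\<close> says that \<open>f \<in> N\<close> as soon as \<open>f\<^sub>j f \<in> N\<close> for every entry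
  \<open>f\<^sub>j\<close> of \<open>f\<close>. Let \<open>M\<close> be the module of all rows that kill every vector killed by the given rows, at
  every point, and let \<open>A\<close> be the ideal of the \<open>p\<close> with \<open>p M \<subseteq> N\<close>. The claim is \<open>1 \<in> A\<close>
  (\<open>semiprime_row_nullstellensatz\<close>).

  Semiprimeness is used twice. First, it makes \<open>A\<close> a radical ideal: if \<open>p\<^sup>2 \<in> A\<close> and \<open>f \<in> M\<close>, then
  \<open>(p f)\<^sub>j (p f) = p\<^sup>2 (f\<^sub>j f) \<in> N\<close>. Secondly, it absorbs error terms: a row \<open>r \<in> M\<close> with all entries
  in \<open>A\<close> satisfies \<open>r\<^sub>j r \<in> N\<close>, hence \<open>r \<in> N\<close>. Now suppose \<open>1 \<notin> A\<close>. Over the zero set of \<open>A\<close>,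
  elimination without division finds \<open>\<delta> \<notin> A\<close> such that \<open>\<delta> f\<close> is, for every \<open>f \<in> M\<close>, a combination of
  the given rows up to a row with entries in \<open>A\<close> (\<open>radical_row_elimination\<close>). That error row is
  absorbed, so \<open>\<delta> M \<subseteq> N\<close> and \<open>\<delta> \<in> A\<close>, a contradiction.

  The geometric input is Hilbert's Nullstellensatz for a radical ideal (\<open>nullstellensatz\<close>). By
  Zorn's lemma it reduces to prime ideals, and for these a point avoiding a given polynomial is
  built one coordinate at a time (\<open>prime_point_extension\<close>).
\<close>

section \<open>Ideals, radical ideals and prime ideals of a subring\<close>

text \<open>
  Induction on the number of variables compares polynomial rings that live in one ambient type,
  so ideal theory is developed relative to a subring \<open>S\<close> of a type.
\<close>

locale coefficient_ring =
  fixes S :: "'r::comm_ring_1 set"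
  assumes zero_closed: "0 \<in> S"
    and one_closed: "1 \<in> S"
    and add_closed: "x \<in> S \<Longrightarrow> y \<in> S \<Longrightarrow> x + y \<in> S"
    and uminus_closed: "x \<in> S \<Longrightarrow> - x \<in> S"
    and mult_closed: "x \<in> S \<Longrightarrow> y \<in> S \<Longrightarrow> x * y \<in> S"
begin

lemma diff_closed: "x \<in> S \<Longrightarrow> y \<in> S \<Longrightarrow> x - y \<in> S"
  using add_closed[of x "- y"] uminus_closed by simp

lemma power_closed: "x \<in> S \<Longrightarrow> x ^ k \<in> S"
  by (induction k) (auto intro: one_closed mult_closed)

lemma sum_closed: "(\<And>i. i \<in> A \<Longrightarrow> f i \<in> S) \<Longrightarrow> sum f A \<in> S"
  by (induction A rule: infinite_finite_induct) (auto intro: zero_closed add_closed)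

end

definition ideal_in :: "'r::comm_ring_1 set \<Rightarrow> 'r set \<Rightarrow> bool" where
  "ideal_in S I \<longleftrightarrow> I \<subseteq> S \<and> 0 \<in> I \<and> (\<forall>x\<in>I. \<forall>y\<in>I. x + y \<in> I) \<and> (\<forall>s\<in>S. \<forall>x\<in>I. s * x \<in> I)"

definition radical_in :: "'r::comm_ring_1 set \<Rightarrow> 'r set \<Rightarrow> bool" where
  "radical_in S I \<longleftrightarrow> ideal_in S I \<and> (\<forall>x\<in>S. x * x \<in> I \<longrightarrow> x \<in> I)"

definition prime_in :: "'r::comm_ring_1 set \<Rightarrow> 'r set \<Rightarrow> bool" where
  "prime_in S P \<longleftrightarrow> ideal_in S P \<and> 1 \<notin> P \<and> (\<forall>x\<in>S. \<forall>y\<in>S. x * y \<in> P \<longrightarrow> x \<in> P \<or> y \<in> P)"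

lemma ideal_inD:
  assumes "ideal_in S I"
  shows "I \<subseteq> S" "0 \<in> I" "\<And>x y. x \<in> I \<Longrightarrow> y \<in> I \<Longrightarrow> x + y \<in> I"
    "\<And>s x. s \<in> S \<Longrightarrow> x \<in> I \<Longrightarrow> s * x \<in> I"
  using assms by (simp_all add: ideal_in_def)

lemma ideal_in_sum:
  assumes "ideal_in S I" "\<And>i. i \<in> A \<Longrightarrow> f i \<in> I"
  shows "sum f A \<in> I"
  using assms(2)
  by (induction A rule: infinite_finite_induct) (auto intro: ideal_inD(2,3)[OF assms(1)])

lemma prime_in_power:
  assumes "prime_in S P" "coefficient_ring S" "x \<in> S" "x ^ k \<in> P"
  shows "x \<in> P"
  using assms(4)
proof (induction k)
  case 0
  then show ?case using assms(1) by (simp add: prime_in_def)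
next
  case (Suc k)
  then show ?case
    using assms(1,3) coefficient_ring.power_closed[OF assms(2,3)]
    by (auto simp: prime_in_def)
qed

context coefficient_ring
begin

lemma ideal_in_diff:
  assumes "ideal_in S I" "x \<in> I" "y \<in> I"
  shows "x - y \<in> I"
  using ideal_inD(3)[OF assms(1,2) ideal_inD(4)[OF assms(1) uminus_closed[OF one_closed] assms(3)]]
  by simp

lemma ideal_in_add_principal:
  assumes I: "ideal_in S I" and a: "a \<in> S"
  shows "ideal_in S {x + s * a | x s. x \<in> I \<and> s \<in> S}" (is "ideal_in S ?J")
  unfolding ideal_in_def
proof (intro conjI ballI)
  note D = ideal_inD[OF I]
  show "?J \<subseteq> S"
    using D(1) a by (auto intro!: add_closed mult_closed)
  show "0 \<in> ?J"
    using D(2) zero_closed by (intro CollectI exI[of _ 0]) simp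
  show "y + z \<in> ?J" if "y \<in> ?J" "z \<in> ?J" for y z
  proof -
    from that(1) obtain x s where "y = x + s * a" "x \<in> I" "s \<in> S"
      by blast
    moreover from that(2) obtain x' s' where "z = x' + s' * a" "x' \<in> I" "s' \<in> S"
      by blast
    ultimately have "y + z = (x + x') + (s + s') * a" "x + x' \<in> I" "s + s' \<in> S"
      using D(3) add_closed by (auto simp: algebra_simps)
    then show ?thesis by blast
  qed
  show "t * y \<in> ?J" if "t \<in> S" "y \<in> ?J" for t y
  proof -
    from that(2) obtain x s where "y = x + s * a" "x \<in> I" "s \<in> S"
      by blast
    then have "t * y = t * x + (t * s) * a" "t * x \<in> I" "t * s \<in> S"
      using D(4) mult_closed that(1) by (auto simp: algebra_simps)
    then show ?thesis by blast
  qed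
qed

lemma radical_in_power:
  assumes A: "radical_in S A" and x: "x \<in> S" and k: "k > 0" "x ^ k \<in> A"
  shows "x \<in> A"
  using k
proof (induction k rule: less_induct)
  case (less k)
  show ?case
  proof (cases "k = 1")
    case True
    then show ?thesis using less.prems by simp
  next
    case False
    define j where "j = (k + 1) div 2"
    have j: "0 < j" "j < k" "k \<le> 2 * j"
      using less.prems(1) False unfolding j_def by presburger+
    have "x ^ (2 * j - k) * x ^ k \<in> A"
      using A less.prems(2) power_closed[OF x] by (simp add: radical_in_def ideal_in_def)
    moreover have "x ^ (2 * j - k) * x ^ k = x ^ j * x ^ j"
      using j(3) by (simp flip: power_add mult_2)
    ultimately have "x ^ j \<in> A"
      using A power_closed[OF x] by (simp add: radical_in_def)
    with less.IH j show ?thesis by blast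
  qed
qed

text \<open>
  An ideal that is maximal among those containing \<open>A\<close> and avoiding the powers of \<open>p\<close> is prime.
\<close>

lemma radical_in_imp_prime_avoiding:
  assumes A: "radical_in S A" and p: "p \<in> S" "p \<notin> A"
  obtains P where "prime_in S P" "A \<subseteq> P" "p \<notin> P"
proof -
  define \<F> where "\<F> = {I. ideal_in S I \<and> A \<subseteq> I \<and> (\<forall>k. p ^ k \<notin> I)}"
  have idA: "ideal_in S A"
    using A by (simp add: radical_in_def)
  have "p ^ k \<notin> A" for k
  proof (cases k)
    case 0
    then show ?thesis
      using ideal_inD(4)[OF idA p(1), of 1] p(2) by auto
  qed (use radical_in_power[OF A p(1)] p(2) in blast)
  then have "A \<in> \<F>"
    using idA by (simp add: \<F>_def)
  moreover have "\<Union>\<C> \<in> \<F>" if ne: "\<C> \<noteq> {}" and ch: "subset.chain \<F> \<C>" for \<C>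
  proof -
    have sub: "\<C> \<subseteq> \<F>" and tot: "\<And>I J. I \<in> \<C> \<Longrightarrow> J \<in> \<C> \<Longrightarrow> I \<subseteq> J \<or> J \<subseteq> I"
      using ch by (auto simp: subset.chain_def)
    have id: "ideal_in S I" if "I \<in> \<C>" for I
      using sub that by (auto simp: \<F>_def)
    have "x + y \<in> \<Union>\<C>" if xy: "x \<in> \<Union>\<C>" "y \<in> \<Union>\<C>" for x y
    proof -
      obtain I J where IJ: "I \<in> \<C>" "x \<in> I" "J \<in> \<C>" "y \<in> J"
        using xy by blast
      then consider "x \<in> J" | "y \<in> I"
        using tot by blast
      then show ?thesis
        using ideal_inD(3)[OF id] IJ by cases blast+
    qed
    moreover have "\<Union>\<C> \<subseteq> S"
      using ideal_inD(1)[OF id] by (rule Union_least)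
    moreover have "0 \<in> \<Union>\<C>"
      using ne ideal_inD(2)[OF id] by auto
    moreover have "s * x \<in> \<Union>\<C>" if "s \<in> S" "x \<in> \<Union>\<C>" for s x
      using ideal_inD(4)[OF id that(1)] that(2) by blast
    ultimately have "ideal_in S (\<Union>\<C>)"
      by (simp add: ideal_in_def)
    moreover have "A \<subseteq> \<Union>\<C>"
      using ne sub by (auto simp: \<F>_def)
    moreover have "p ^ k \<notin> \<Union>\<C>" for k
      using sub by (auto simp: \<F>_def)
    ultimately show ?thesis
      by (simp add: \<F>_def)
  qed
  ultimately obtain P where P: "P \<in> \<F>" and max: "\<And>I. I \<in> \<F> \<Longrightarrow> P \<subseteq> I \<Longrightarrow> I = P"
    using subset_Zorn_nonempty[of \<F>] by blast
  have idP: "ideal_in S P" and AP: "A \<subseteq> P" and avoid: "\<And>k. p ^ k \<notin> P"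
    using P by (auto simp: \<F>_def)
  note D = ideal_inD[OF idP]
  \<comment> \<open>Adjoining any element outside \<open>P\<close> captures a power of \<open>p\<close>.\<close>
  have power: "\<exists>k x s. x \<in> P \<and> s \<in> S \<and> p ^ k = x + s * a" if a: "a \<in> S" "a \<notin> P" for a
  proof -
    let ?J = "{x + s * a | x s. x \<in> P \<and> s \<in> S}"
    have "P \<subseteq> ?J"
    proof
      fix x assume "x \<in> P"
      then show "x \<in> ?J"
        using zero_closed by (intro CollectI exI[of _ x] exI[of _ 0]) simp
    qed
    moreover have "a \<in> ?J"
      using D(2) one_closed by (intro CollectI exI[of _ 0] exI[of _ 1]) simp
    ultimately have "?J \<notin> \<F>"
      using max[of ?J] a(2) by blast
    then show ?thesis
      using ideal_in_add_principal[OF idP a(1)] \<open>P \<subseteq> ?J\<close> AP by (auto simp: \<F>_def)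
  qed
  have "a \<in> P \<or> b \<in> P" if ab: "a \<in> S" "b \<in> S" "a * b \<in> P" for a b
  proof (rule ccontr)
    assume "\<not> (a \<in> P \<or> b \<in> P)"
    then have "a \<notin> P" "b \<notin> P"
      by simp_all
    from power[OF ab(1) this(1)] obtain k x s where x: "x \<in> P" "s \<in> S" "p ^ k = x + s * a"
      by blast
    from power[OF ab(2) \<open>b \<notin> P\<close>] obtain l y t where y: "y \<in> P" "t \<in> S" "p ^ l = y + t * b"
      by blast
    have "p ^ (k + l) = p ^ l * x + (s * a) * y + (s * t) * (a * b)"
      unfolding power_add x(3) y(3) by (simp add: algebra_simps)
    also have "\<dots> \<in> P"
      using D(4)[OF power_closed[OF p(1)] x(1)] D(4)[OF mult_closed[OF x(2) ab(1)] y(1)]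
        D(4)[OF mult_closed[OF x(2) y(2)] ab(3)] by (intro D(3))
    finally show False
      using avoid by blast
  qed
  then have "prime_in S P"
    using idP avoid[of 0] by (auto simp: prime_in_def)
  then show thesis
    using that AP avoid[of 1] by simp
qed

end

section \<open>Polynomials with coefficients in a subring\<close>

definition polys_over :: "'r::comm_ring_1 set \<Rightarrow> 'r poly set" where
  "polys_over S = {q. \<forall>i. coeff q i \<in> S}"

lemma polys_over_mult_ideal:
  assumes "ideal_in S I" "p \<in> polys_over S" "q \<in> polys_over I"
  shows "p * q \<in> polys_over I"
  using assms(2,3) by (auto simp: polys_over_def coeff_mult
      intro!: ideal_in_sum[OF assms(1)] ideal_inD(4)[OF assms(1)])

context coefficient_ring
begin

lemma polys_over_coefficient_ring: "coefficient_ring (polys_over S)"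
proof
  show "p * q \<in> polys_over S" if "p \<in> polys_over S" "q \<in> polys_over S" for p q
    using that by (auto simp: polys_over_def coeff_mult intro!: sum_closed mult_closed)
qed (auto simp: polys_over_def intro: zero_closed one_closed add_closed uminus_closed)

lemma monom_in_polys_over: "c \<in> S \<Longrightarrow> monom c i \<in> polys_over S"
  by (simp add: polys_over_def zero_closed)

lemma const_in_polys_over: "c \<in> S \<Longrightarrow> [:c:] \<in> polys_over S"
  using monom_in_polys_over[of c 0] by (simp add: monom_0)

lemma smult_in_polys_over: "c \<in> S \<Longrightarrow> q \<in> polys_over S \<Longrightarrow> Polynomial.smult c q \<in> polys_over S"
  by (simp add: polys_over_def mult_closed)

lemma lead_coeff_in: "q \<in> polys_over S \<Longrightarrow> lead_coeff q \<in> S"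
  by (simp add: polys_over_def)

end

lemma degree_diff_lead_less:
  fixes g h :: "'a::comm_ring_1 poly"
  assumes "degree g > 0" "degree h \<le> degree g" "coeff h (degree g) = lead_coeff g"
  shows "degree (g - h) < degree g"
proof -
  have "degree (g - h) \<le> degree g"
    using assms by (intro degree_diff_le) auto
  moreover have "coeff (g - h) (degree g) = 0"
    using assms by simp
  ultimately show ?thesis
    using assms(1) by (metis degree_0 le_neq_implies_less leading_coeff_0_iff)
qed

text \<open>
  Division with remainder after multiplying by a power of the leading coefficient of the divisor,
  which replaces dividing by it. The bound on the quotient serves a minimality argument below.
\<close>

lemma (in coefficient_ring) pseudo_division:
  assumes h: "h \<in> polys_over S" "degree h > 0" and g: "g \<in> polys_over S"
  obtains N s r where "Polynomial.smult (lead_coeff h ^ N) g = s * h + r" "s \<in> polys_over S" "r \<in> polys_over S"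
    "degree r < degree h" "degree s \<le> degree g - degree h"
proof -
  interpret SX: coefficient_ring "polys_over S"
    by (rule polys_over_coefficient_ring)
  let ?c = "lead_coeff h"
  have "\<exists>N s r. Polynomial.smult (?c ^ N) g = s * h + r \<and> s \<in> polys_over S \<and> r \<in> polys_over S \<and>
      degree r < degree h \<and> degree s \<le> degree g - degree h"
    using g
  proof (induction "degree g" arbitrary: g rule: less_induct)
    case less
    show ?case
    proof (cases "degree g < degree h")
      case True
      then show ?thesis
        using less.prems SX.zero_closed by (intro exI[of _ 0] exI[of _ g]) auto
    next
      case False
      let ?m = "monom (lead_coeff g) (degree g - degree h)"
      define g' where "g' = Polynomial.smult ?c g - ?m * h"
      have m: "?m \<in> polys_over S"
        using less.prems by (intro monom_in_polys_over lead_coeff_in)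
      have "degree (?m * h) \<le> degree g"
        using degree_mult_le[of ?m h] degree_monom_le[of "lead_coeff g" "degree g - degree h"] False
        by linarith
      then have "degree g' \<le> degree g"
        unfolding g'_def using degree_smult_le[of ?c g] by (intro degree_diff_le) auto
      moreover have "coeff g' (degree g) = 0"
        using False by (simp add: g'_def coeff_monom_mult)
      ultimately have deg: "degree g' < degree g"
        using False h(2) by (metis degree_0 le_neq_implies_less leading_coeff_0_iff)
      have "g' \<in> polys_over S"
        unfolding g'_def using h less.prems m
        by (intro SX.diff_closed SX.mult_closed smult_in_polys_over lead_coeff_in)
      with less.hyps[OF deg] obtain N s r where
        IH: "Polynomial.smult (?c ^ N) g' = s * h + r" "s \<in> polys_over S" "r \<in> polys_over S"
        "degree r < degree h" "degree s \<le> degree g' - degree h"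
        by blast
      let ?s = "s + Polynomial.smult (?c ^ N) ?m"
      have "Polynomial.smult (?c ^ Suc N) g = Polynomial.smult (?c ^ N) (g' + ?m * h)"
        by (simp add: g'_def mult.commute)
      also have "\<dots> = ?s * h + r"
        using IH(1) by (simp add: smult_add_right algebra_simps)
      finally have "Polynomial.smult (?c ^ Suc N) g = ?s * h + r" .
      moreover have "?s \<in> polys_over S"
        using IH(2) m h by (intro SX.add_closed smult_in_polys_over power_closed lead_coeff_in)
      moreover have "degree ?s \<le> degree g - degree h"
      proof (rule degree_add_le)
        show "degree s \<le> degree g - degree h"
          using IH(5) deg by linarith
        show "degree (Polynomial.smult (?c ^ N) ?m) \<le> degree g - degree h"
          using degree_smult_le degree_monom_le by (rule le_trans)
      qed
      ultimately show ?thesis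
        using IH(3,4) by blast
    qed
  qed
  then show thesis
    using that by blast
qed

section \<open>Extending a point by one coordinate\<close>

context coefficient_ring
begin

lemma prime_in_constants:
  assumes Q: "prime_in (polys_over S) Q"
  shows "prime_in S {c \<in> S. [:c:] \<in> Q}"
proof -
  have id: "ideal_in (polys_over S) Q"
    using Q by (simp add: prime_in_def)
  note D = ideal_inD[OF id]
  show ?thesis
    unfolding prime_in_def ideal_in_def
  proof (intro conjI ballI impI)
    show "1 \<notin> {c \<in> S. [:c:] \<in> Q}"
      using Q by (simp add: prime_in_def one_pCons)
    show "s * x \<in> {c \<in> S. [:c:] \<in> Q}" if "s \<in> S" "x \<in> {c \<in> S. [:c:] \<in> Q}" for s x
      using that D(4)[OF const_in_polys_over[of s], of "[:x:]"] by (simp add: mult_closed mult.commute)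
    show "x + y \<in> {c \<in> S. [:c:] \<in> Q}"
      if "x \<in> {c \<in> S. [:c:] \<in> Q}" "y \<in> {c \<in> S. [:c:] \<in> Q}" for x y
      using that D(3)[of "[:x:]" "[:y:]"] by (simp add: add_closed)
    show "x \<in> {c \<in> S. [:c:] \<in> Q} \<or> y \<in> {c \<in> S. [:c:] \<in> Q}"
      if "x \<in> S" "y \<in> S" "x * y \<in> {c \<in> S. [:c:] \<in> Q}" for x y
    proof -
      have "[:x:] * [:y:] \<in> Q"
        using that(3) by (simp add: mult.commute)
      then show ?thesis
        using Q that(1,2) const_in_polys_over unfolding prime_in_def by blast
    qed
  qed (use D(2) zero_closed in auto)
qed

lemma polys_over_constants_subset:
  assumes Q: "ideal_in (polys_over S) Q"
  shows "polys_over {c \<in> S. [:c:] \<in> Q} \<subseteq> Q"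
proof
  fix q assume q: "q \<in> polys_over {c \<in> S. [:c:] \<in> Q}"
  have "(\<Sum>i\<le>degree q. monom (coeff q i) i) \<in> Q"
  proof (rule ideal_in_sum[OF Q])
    fix i
    have "monom 1 i * [:coeff q i:] \<in> Q"
      using q by (intro ideal_inD(4)[OF Q] monom_in_polys_over one_closed) (simp add: polys_over_def)
    then show "monom (coeff q i) i \<in> Q"
      by (simp add: smult_monom)
  qed
  then show "q \<in> Q"
    by (simp add: poly_as_sum_of_monoms)
qed

end

lemma alg_closed_poly_nonzero_point:
  fixes q :: "'k::alg_closed_field poly"
  assumes "q \<noteq> 0"
  obtains b where "poly q b \<noteq> 0"
proof (cases q)
  case (pCons a r)
  show thesis
  proof (cases "r = 0")
    case True
    then show thesis
      using that[of 0] pCons assms by auto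
  next
    case False
    \<comment> \<open>A root of \<open>q - 1\<close> will do.\<close>
    obtain b where "poly (pCons (a - 1) r) b = 0"
      using alg_closed_imp_poly_has_root[of "pCons (a - 1) r"] False by auto
    then have "poly q b = 1"
      using pCons by (simp add: algebra_simps)
    then show thesis
      using that[of b] by simp
  qed
qed

text \<open>
  This is the extension theorem for homomorphisms into an algebraically closed field, in terms of
  polynomials. A homomorphism \<open>\<phi>\<close> on \<open>S\<close> that kills the constants in \<open>Q\<close> extends to \<open>S[x]\<close> by a
  value \<open>b\<close> for \<open>x\<close> so that it kills \<open>Q\<close> and not \<open>p\<close>, provided that \<open>\<phi>\<close> avoids the zeros of one
  constant \<open>u\<close> depending on \<open>Q\<close> and \<open>p\<close> only.

  If \<open>x\<close> is transcendental modulo \<open>Q\<close>, then \<open>u\<close> is a coefficient of \<open>p\<close>, and \<open>b\<close> is any point at which the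
  image of \<open>p\<close> is nonzero. Otherwise, let \<open>q\<close> be an element of least degree in \<open>Q\<close> whose
  coefficients are not all in \<open>Q\<close>, and let \<open>b\<close> be a root of its image. By pseudo-division, \<open>b\<close> is then a
  zero of \<open>Q\<close> wherever the leading coefficient of \<open>q\<close> is nonzero, and a constant \<open>w \<notin> Q\<close> that is a
  multiple of \<open>p\<close> modulo \<open>Q\<close> prevents \<open>p\<close> from vanishing at \<open>b\<close>.
\<close>

lemma (in coefficient_ring) prime_point_extension:
  fixes Q :: "'r poly set" and p :: "'r poly"
  assumes Q: "prime_in (polys_over S) Q" and p: "p \<in> polys_over S" "p \<notin> Q"
  obtains u where "u \<in> S" "[:u:] \<notin> Q"
    "\<And>\<phi> :: 'r \<Rightarrow> 'k::alg_closed_field. comm_ring_hom \<phi> \<Longrightarrow> (\<And>c. c \<in> S \<Longrightarrow> [:c:] \<in> Q \<Longrightarrow> \<phi> c = 0) \<Longrightarrow> \<phi> u \<noteq> 0 \<Longrightarrow>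
      \<exists>b. (\<forall>g\<in>Q. poly (map_poly \<phi> g) b = 0) \<and> poly (map_poly \<phi> p) b \<noteq> 0"
proof -
  interpret SX: coefficient_ring "polys_over S"
    by (rule polys_over_coefficient_ring)
  define P0 where "P0 = {c \<in> S. [:c:] \<in> Q}"
  have P0: "prime_in S P0"
    unfolding P0_def by (rule prime_in_constants[OF Q])
  then have idP0: "ideal_in S P0"
    by (simp add: prime_in_def)
  have idQ: "ideal_in (polys_over S) Q"
    using Q by (simp add: prime_in_def)
  note D = ideal_inD[OF idQ]
  have P0_add: "f + g \<in> polys_over P0" if "f \<in> polys_over P0" "g \<in> polys_over P0" for f g
    using that ideal_inD(3)[OF idP0] by (simp add: polys_over_def)
  have P0Q: "polys_over P0 \<subseteq> Q"
    unfolding P0_def by (rule polys_over_constants_subset[OF idQ])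
  have not_P0_power: "[:c ^ N:] \<notin> Q" if "c \<in> S" "c \<notin> P0" for c N
    using prime_in_power[OF P0 coefficient_ring_axioms that(1), of N] that power_closed by (auto simp: P0_def)
  have smult_eq: "Polynomial.smult c g = [:c:] * g" for c and g :: "'r poly"
    by simp
  have kill: "map_poly \<phi> r = 0" if "\<And>c. c \<in> S \<Longrightarrow> [:c:] \<in> Q \<Longrightarrow> \<phi> c = 0" "r \<in> polys_over P0" "\<phi> 0 = 0"
    for \<phi> :: "'r \<Rightarrow> 'k" and r
    using that by (intro poly_eqI) (auto simp: coeff_map_poly polys_over_def P0_def)
  show thesis
  proof (cases "Q \<subseteq> polys_over P0")
    case True
    have "p \<notin> polys_over P0"
      using p P0Q by blast
    then obtain i where i: "coeff p i \<notin> P0"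
      by (auto simp: polys_over_def)
    show thesis
    proof (rule that)
      show "coeff p i \<in> S" and "[:coeff p i:] \<notin> Q"
        using p(1) i by (auto simp: polys_over_def P0_def)
      fix \<phi> :: "'r \<Rightarrow> 'k"
      assume \<phi>: "comm_ring_hom \<phi>" and zero: "\<And>c. c \<in> S \<Longrightarrow> [:c:] \<in> Q \<Longrightarrow> \<phi> c = 0"
        and nz: "\<phi> (coeff p i) \<noteq> 0"
      interpret comm_ring_hom \<phi> by fact
      have "map_poly \<phi> p \<noteq> 0"
        using nz by (metis coeff_map_poly_hom coeff_0)
      then obtain b where "poly (map_poly \<phi> p) b \<noteq> 0"
        by (rule alg_closed_poly_nonzero_point)
      moreover have "map_poly \<phi> g = 0" if "g \<in> Q" for g
        using kill[of \<phi> g] zero True that by auto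
      ultimately show "\<exists>b. (\<forall>g\<in>Q. poly (map_poly \<phi> g) b = 0) \<and> poly (map_poly \<phi> p) b \<noteq> 0"
        by (intro exI[of _ b]) simp
    qed
  next
    case False
    then obtain q where q: "q \<in> Q" "q \<notin> polys_over P0"
      and q_min: "\<And>g. g \<in> Q \<Longrightarrow> degree g < degree q \<Longrightarrow> g \<in> polys_over P0"
      using ex_has_least_nat[of "\<lambda>g. g \<in> Q \<and> g \<notin> polys_over P0" _ degree] by (metis not_less subsetI)
    have qS: "q \<in> polys_over S"
      using q(1) D(1) by blast
    have deg_q: "degree q > 0"
    proof (rule ccontr)
      assume "\<not> degree q > 0"
      then obtain c where "q = [:c:]"
        by (auto elim: degree_eq_zeroE)
      then show False
        using q qS ideal_inD(2)[OF idP0] by (auto simp: polys_over_def P0_def coeff_pCons gr0_conv_Suc split: nat.splits)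
    qed
    have lc_q: "lead_coeff q \<notin> P0"
    proof
      let ?m = "monom (lead_coeff q) (degree q)"
      assume "lead_coeff q \<in> P0"
      then have m: "?m \<in> polys_over P0"
        using ideal_inD(2)[OF idP0] by (simp add: polys_over_def)
      then have "q - ?m \<in> Q"
        using q(1) P0Q by (intro SX.ideal_in_diff[OF idQ]) auto
      moreover have "degree (q - ?m) < degree q"
        using deg_q by (intro degree_diff_lead_less) (auto simp: degree_monom_le)
      ultimately have "q - ?m \<in> polys_over P0"
        by (rule q_min)
      then show False
        using P0_add[OF _ m] q(2) by fastforce
    qed
    let ?c = "lead_coeff q"
    \<comment> \<open>An element of least degree in \<open>(Q + (p)) - Q\<close> will turn out to be the constant \<open>w\<close>.\<close>
    have cS: "?c \<in> S"
      by (rule lead_coeff_in[OF qS])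
    define T where "T = {h \<in> polys_over S. h \<notin> Q \<and> (\<exists>s \<in> polys_over S. h - s * p \<in> Q)}"
    have "p - 1 * p \<in> Q"
      using D(2) by simp
    then have "p \<in> T"
      using p SX.one_closed unfolding T_def by blast
    then obtain h where h: "h \<in> T" and h_min: "\<And>g. degree g < degree h \<Longrightarrow> g \<notin> T"
      using ex_has_least_nat[of "\<lambda>g. g \<in> T" _ degree] by (metis not_less)
    have hS: "h \<in> polys_over S" and hQ: "h \<notin> Q"
      using h by (auto simp: T_def)
    have T_add: "h' \<in> T" if "h' \<notin> Q" "t \<in> polys_over S" "x \<in> Q" "h' = t * h + x" for h' t x
    proof -
      obtain s where s: "s \<in> polys_over S" "h - s * p \<in> Q"
        using h by (auto simp: T_def)
      have "h' - (t * s) * p = t * (h - s * p) + x"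
        using that(4) by (simp add: algebra_simps)
      also have "\<dots> \<in> Q"
        using that s by (intro D(3,4))
      finally have "h' - (t * s) * p \<in> Q" .
      moreover have "h' \<in> polys_over S"
        using that hS D(1) SX.add_closed SX.mult_closed by blast
      ultimately show ?thesis
        using that(1,2) s(1) SX.mult_closed unfolding T_def by blast
    qed
    have deg_h: "degree h = 0"
    proof (rule ccontr)
      assume "degree h \<noteq> 0"
      then have pos: "degree h > 0"
        by simp
      have lc_h: "lead_coeff h \<notin> P0"
      proof
        let ?m = "monom (lead_coeff h) (degree h)"
        assume "lead_coeff h \<in> P0"
        then have "?m \<in> Q"
          using ideal_inD(2)[OF idP0] P0Q by (auto simp: polys_over_def)
        then have m: "- ?m \<in> Q"
          using SX.ideal_in_diff[OF idQ D(2)] by (metis diff_0)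
        have "h - ?m \<notin> Q"
          using hQ D(3)[of "h - ?m" ?m] \<open>?m \<in> Q\<close> by auto
        then have "h - ?m \<in> T"
          using m SX.one_closed by (intro T_add[of _ 1 "- ?m"]) auto
        moreover have "degree (h - ?m) < degree h"
          using pos by (intro degree_diff_lead_less) (auto simp: degree_monom_le)
        ultimately show False
          using h_min by blast
      qed
      have less: "degree h < degree q"
      proof (rule ccontr)
        assume "\<not> degree h < degree q"
        obtain N s r where r: "Polynomial.smult (?c ^ N) h = s * q + r" "s \<in> polys_over S"
          "r \<in> polys_over S" "degree r < degree q"
          using pseudo_division[OF qS deg_q hS] by metis
        have sq: "s * q \<in> Q"
          using r(2) q(1) by (rule D(4))
        have "[:?c ^ N:] * h \<notin> Q"
          using Q not_P0_power[OF cS lc_q] hQ hS const_in_polys_over[OF power_closed[OF cS]]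
          unfolding prime_in_def by blast
        then have "r \<notin> Q"
          using sq D(3) r(1) by (metis smult_eq)
        moreover have "- (s * q) \<in> Q"
          using SX.ideal_in_diff[OF idQ D(2) sq] by simp
        moreover have "r = [:?c ^ N:] * h + - (s * q)"
          using r(1) by simp
        ultimately have "r \<in> T"
          using const_in_polys_over[OF power_closed[OF cS]] by (intro T_add)
        then show False
          using h_min r(4) \<open>\<not> degree h < degree q\<close> by auto
      qed
      let ?l = "lead_coeff h"
      have lS: "?l \<in> S"
        by (rule lead_coeff_in[OF hS])
      \<comment> \<open>Both quotient and remainder lie in \<open>Q\<close> and have smaller degree than \<open>q\<close>, so their
        coefficients lie in \<open>Q\<close>. Then so does \<open>?l ^ N * ?c\<close>, contrary to primality.\<close>
      obtain N s r where r: "Polynomial.smult (?l ^ N) q = s * h + r" "s \<in> polys_over S"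
        "r \<in> polys_over S" "degree r < degree h" "degree s \<le> degree q - degree h"
        using pseudo_division[OF hS pos qS] by metis
      have lq: "[:?l ^ N:] * q \<in> Q"
        using q(1) const_in_polys_over[OF power_closed[OF lS]] by (intro D(4))
      have rQ: "r \<in> Q"
      proof (rule ccontr)
        assume "r \<notin> Q"
        moreover have "r = - s * h + [:?l ^ N:] * q"
          using r(1) by simp
        ultimately have "r \<in> T"
          using lq SX.uminus_closed[OF r(2)] by (intro T_add)
        then show False
          using h_min r(4) by blast
      qed
      have "[:?l ^ N:] * q - r \<in> Q"
        using lq rQ by (rule SX.ideal_in_diff[OF idQ])
      moreover have "[:?l ^ N:] * q - r = s * h"
        using r(1) by simp
      ultimately have "s \<in> Q"
        using Q r(2) hS hQ unfolding prime_in_def by auto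
      then have "s \<in> polys_over P0"
        using r(5) less pos by (intro q_min) auto
      then have "h * s \<in> polys_over P0"
        using idP0 hS by (intro polys_over_mult_ideal)
      moreover have "r \<in> polys_over P0"
        using rQ r(4) less by (intro q_min) auto
      ultimately have "Polynomial.smult (?l ^ N) q \<in> polys_over P0"
        unfolding r(1) by (simp add: P0_add mult.commute)
      then have "?l ^ N * ?c \<in> P0"
        by (auto simp: polys_over_def dest: spec[of _ "degree q"])
      then show False
        using P0 lc_q cS power_closed[OF lS] prime_in_power[OF P0 coefficient_ring_axioms lS] lc_h
        unfolding prime_in_def by blast
    qed
    obtain w where w: "h = [:w:]"
      using deg_h by (auto elim: degree_eq_zeroE)
    have wS: "w \<in> S"
      using hS w by (auto simp: polys_over_def dest: spec[of _ 0])
    obtain s where s: "s \<in> polys_over S" "[:w:] - s * p \<in> Q"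
      using h w by (auto simp: T_def)
    show thesis
    proof (rule that)
      show "?c * w \<in> S"
        using cS wS by (rule mult_closed)
      have "w \<notin> P0"
        using hQ w by (simp add: P0_def)
      then show "[:?c * w:] \<notin> Q"
        using P0 lc_q cS wS mult_closed[OF cS wS] by (auto simp: prime_in_def P0_def)
      fix \<phi> :: "'r \<Rightarrow> 'k"
      assume \<phi>: "comm_ring_hom \<phi>" and zero: "\<And>c. c \<in> S \<Longrightarrow> [:c:] \<in> Q \<Longrightarrow> \<phi> c = 0"
        and nz: "\<phi> (?c * w) \<noteq> 0"
      interpret comm_ring_hom \<phi> by fact
      interpret map: map_poly_comm_ring_hom \<phi> ..
      have nz: "\<phi> ?c \<noteq> 0" "\<phi> w \<noteq> 0"
        using nz by (auto simp: hom_mult)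
      have "degree (map_poly \<phi> q) = degree q"
        using nz(1) by (rule map_poly_degree_eq)
      then obtain b where b: "poly (map_poly \<phi> q) b = 0"
        using alg_closed_imp_poly_has_root[of "map_poly \<phi> q"] deg_q by auto
      have vanish: "poly (map_poly \<phi> g) b = 0" if g: "g \<in> Q" for g
      proof -
        obtain N s r where r: "Polynomial.smult (?c ^ N) g = s * q + r" "s \<in> polys_over S"
          "r \<in> polys_over S" "degree r < degree q"
          using pseudo_division[OF qS deg_q] g D(1) by (metis subsetD)
        have "[:?c ^ N:] * g - s * q \<in> Q"
          using g q(1) r(2) const_in_polys_over[OF power_closed[OF cS]]
          by (intro SX.ideal_in_diff[OF idQ] D(4))
        moreover have "[:?c ^ N:] * g - s * q = r"
          using r(1) by simp
        ultimately have "r \<in> polys_over P0"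
          using r(4) by (auto intro: q_min)
        then have "map_poly \<phi> r = 0"
          using kill[of \<phi> r] zero by auto
        then have "\<phi> ?c ^ N * poly (map_poly \<phi> g) b = 0"
          using arg_cong[OF r(1), of "\<lambda>x. poly (map_poly \<phi> x) b"] b
          by (simp add: hom_distribs)
        then show ?thesis
          using nz(1) by simp
      qed
      have "poly (map_poly \<phi> ([:w:] - s * p)) b = 0"
        using s(2) by (rule vanish)
      then have "\<phi> w = poly (map_poly \<phi> s) b * poly (map_poly \<phi> p) b"
        by (simp add: hom_distribs)
      then have "poly (map_poly \<phi> p) b \<noteq> 0"
        using nz(2) by auto
      then show "\<exists>b. (\<forall>g\<in>Q. poly (map_poly \<phi> g) b = 0) \<and> poly (map_poly \<phi> p) b \<noteq> 0"
        using vanish by blast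
    qed
  qed
qed

section \<open>Evaluation of polynomials\<close>

definition eval_monom :: "(nat \<Rightarrow> 'k::comm_ring_1) \<Rightarrow> (nat \<Rightarrow>\<^sub>0 nat) \<Rightarrow> 'k" where
  "eval_monom a m = (\<Prod>i \<in> Poly_Mapping.keys m. a i ^ Poly_Mapping.lookup m i)"

text \<open>
  Points are functions on all variables, so that a point in \<open>d\<close> coordinates can be extended by one
  more without changing its type.
\<close>

definition eval_at :: "(nat \<Rightarrow> 'k::comm_ring_1) \<Rightarrow> 'k mpoly \<Rightarrow> 'k" where
  "eval_at a p = (\<Sum>m \<in> Poly_Mapping.keys p. Poly_Mapping.lookup p m * eval_monom a m)"

lemma eval_mpoly_eq_eval_at: "eval_mpoly a = eval_at (\<lambda>i. a $ i)"
  by (simp add: fun_eq_iff eval_mpoly_def eval_at_def eval_monom_def)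

lemma eval_monom_superset:
  assumes "finite A" "Poly_Mapping.keys m \<subseteq> A"
  shows "eval_monom a m = (\<Prod>i\<in>A. a i ^ Poly_Mapping.lookup m i)"
  unfolding eval_monom_def using assms by (intro prod.mono_neutral_left) (auto simp: in_keys_iff)

lemma eval_monom_add: "eval_monom a (m + m') = eval_monom a m * eval_monom a m'"
proof -
  let ?A = "Poly_Mapping.keys m \<union> Poly_Mapping.keys m'"
  have "eval_monom a (m + m') = (\<Prod>i\<in>?A. a i ^ Poly_Mapping.lookup (m + m') i)"
    using Poly_Mapping.keys_add[of m m'] by (intro eval_monom_superset) auto
  also have "\<dots> = (\<Prod>i\<in>?A. a i ^ Poly_Mapping.lookup m i) * (\<Prod>i\<in>?A. a i ^ Poly_Mapping.lookup m' i)"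
    by (simp add: lookup_add power_add prod.distrib)
  also have "\<dots> = eval_monom a m * eval_monom a m'"
    by (simp add: eval_monom_superset[of ?A])
  finally show ?thesis .
qed

lemma eval_at_single [simp]: "eval_at a (Poly_Mapping.single m c) = c * eval_monom a m"
  by (simp add: eval_at_def)

lemma eval_at_add: "eval_at a (p + q) = eval_at a p + eval_at a q"
  unfolding eval_at_def by (rule setsum_keys_plus_distrib) (simp_all add: distrib_right)

lemma eval_at_0 [simp]: "eval_at a 0 = 0"
  by (simp add: eval_at_def)

lemma eval_at_sum: "eval_at a (sum f A) = (\<Sum>i\<in>A. eval_at a (f i))"
  by (induction A rule: infinite_finite_induct) (simp_all add: eval_at_add)

lemma sum_single_lookup:
  "(\<Sum>m \<in> Poly_Mapping.keys p. Poly_Mapping.single m (Poly_Mapping.lookup p m)) = p"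
  by (rule poly_mapping_eqI) (auto simp: lookup_sum lookup_single when_def in_keys_iff)

lemma eval_at_mult: "eval_at a (p * q) = eval_at a p * eval_at a q"
proof -
  let ?s = "\<lambda>p m. Poly_Mapping.single m (Poly_Mapping.lookup p m)"
  have "p * q = (\<Sum>m \<in> Poly_Mapping.keys p. ?s p m) * (\<Sum>m \<in> Poly_Mapping.keys q. ?s q m)"
    by (simp add: sum_single_lookup)
  also have "\<dots> = (\<Sum>m \<in> Poly_Mapping.keys p. \<Sum>m' \<in> Poly_Mapping.keys q.
      Poly_Mapping.single (m + m') (Poly_Mapping.lookup p m * Poly_Mapping.lookup q m'))"
    by (simp add: sum_product mult_single)
  also have "eval_at a \<dots> = eval_at a p * eval_at a q"
    by (simp add: eval_at_sum eval_monom_add eval_at_def[of a p] eval_at_def[of a q] sum_product mult_ac)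
  finally show ?thesis .
qed

interpretation eval_at: comm_ring_hom "eval_at a" for a :: "nat \<Rightarrow> 'k::comm_ring_1"
proof
  show "eval_at a 1 = 1"
    by (simp add: eval_monom_def flip: single_one)
qed (simp_all add: eval_at_add eval_at_mult)

lemma coefficient_ring_mpolys: "coefficient_ring (mpolys d)"
  by unfold_locales (auto intro: mpolys_add mpolys_uminus mpolys_mult)

lemma single_in_mpolys: "Poly_Mapping.keys m \<subseteq> {..<d} \<Longrightarrow> Poly_Mapping.single m c \<in> mpolys d"
  by (simp add: mpolys_def)

lemma mpolys_mono: "d \<le> e \<Longrightarrow> mpolys d \<subseteq> mpolys e"
  unfolding mpolys_def by (fastforce simp: subset_iff)

lemma mpolys_keys_less:
  "p \<in> mpolys d \<Longrightarrow> m \<in> Poly_Mapping.keys p \<Longrightarrow> i \<in> Poly_Mapping.keys m \<Longrightarrow> i < d"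
  unfolding mpolys_def by blast

lemma eval_at_cong:
  assumes "p \<in> mpolys d" "\<And>i. i < d \<Longrightarrow> a i = b i"
  shows "eval_at a p = eval_at b p"
proof -
  have "eval_monom a m = eval_monom b m" if "m \<in> Poly_Mapping.keys p" for m
    unfolding eval_monom_def using assms(2) mpolys_keys_less[OF assms(1) that] by (intro prod.cong) auto
  then show ?thesis
    by (simp add: eval_at_def)
qed

lemma mpolys_0_eq_single:
  assumes "p \<in> mpolys 0"
  obtains c where "p = Poly_Mapping.single 0 c"
proof -
  have "Poly_Mapping.keys p \<subseteq> {0}"
    using assms by (auto simp: mpolys_def)
  then have "p = Poly_Mapping.single 0 (Poly_Mapping.lookup p 0)"
    by (intro poly_mapping_eqI) (auto simp: lookup_single when_def in_keys_iff)
  then show thesis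
    by (rule that)
qed

definition mpoly_var :: "nat \<Rightarrow> 'k::comm_ring_1 mpoly" where
  "mpoly_var i = Poly_Mapping.single (Poly_Mapping.single i 1) 1"

lemma eval_at_mpoly_var [simp]: "eval_at a (mpoly_var i) = a i"
  by (simp add: mpoly_var_def eval_monom_def)

lemma mpoly_var_in_mpolys: "mpoly_var d \<in> mpolys (Suc d)"
  unfolding mpoly_var_def by (rule single_in_mpolys) simp

lemma mpoly_var_power: "mpoly_var i ^ k = Poly_Mapping.single (Poly_Mapping.single i k) 1"
  by (induction k) (simp_all add: mpoly_var_def mult_single flip: single_add)

lemma mpolys_Suc_eq: "mpolys (Suc d) = (\<lambda>q. poly q (mpoly_var d)) ` polys_over (mpolys d)"
proof (intro equalityI subsetI)
  interpret coefficient_ring "mpolys d :: 'a mpoly set"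
    by (rule coefficient_ring_mpolys)
  interpret SX: coefficient_ring "polys_over (mpolys d :: 'a mpoly set)"
    by (rule polys_over_coefficient_ring)
  fix p :: "'a mpoly"
  assume p: "p \<in> mpolys (Suc d)"
  define q where "q = (\<lambda>m. monom (Poly_Mapping.single (m - Poly_Mapping.single d (Poly_Mapping.lookup m d))
      (Poly_Mapping.lookup p m)) (Poly_Mapping.lookup m d))"
  have "poly (q m) (mpoly_var d) = Poly_Mapping.single m (Poly_Mapping.lookup p m)" for m
  proof -
    have "m - Poly_Mapping.single d (Poly_Mapping.lookup m d)
        + Poly_Mapping.single d (Poly_Mapping.lookup m d) = m"
      by (rule poly_mapping_eqI) (simp add: lookup_add lookup_minus lookup_single when_def)
    then show ?thesis
      by (simp add: q_def poly_monom mpoly_var_power mult_single)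
  qed
  then have "p = poly (\<Sum>m \<in> Poly_Mapping.keys p. q m) (mpoly_var d)"
    by (simp add: poly_sum sum_single_lookup)
  moreover have "q m \<in> polys_over (mpolys d)" if "m \<in> Poly_Mapping.keys p" for m
    unfolding q_def
  proof (intro monom_in_polys_over single_in_mpolys subsetI)
    fix i
    assume "i \<in> Poly_Mapping.keys (m - Poly_Mapping.single d (Poly_Mapping.lookup m d))"
    then have "i \<in> Poly_Mapping.keys m" "i \<noteq> d"
      by (auto simp: in_keys_iff lookup_minus lookup_single when_def)
    then show "i \<in> {..<d}"
      using p that mpolys_keys_less[of p "Suc d" m i] by auto
  qed
  ultimately show "p \<in> (\<lambda>q. poly q (mpoly_var d)) ` polys_over (mpolys d)"
    by (intro image_eqI[of _ _ "\<Sum>m \<in> Poly_Mapping.keys p. q m"] SX.sum_closed)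
next
  interpret coefficient_ring "mpolys (Suc d) :: 'a mpoly set"
    by (rule coefficient_ring_mpolys)
  fix p :: "'a mpoly"
  assume "p \<in> (\<lambda>q. poly q (mpoly_var d)) ` polys_over (mpolys d)"
  then obtain q where "p = poly q (mpoly_var d)" "q \<in> polys_over (mpolys d)"
    by blast
  then show "p \<in> mpolys (Suc d)"
    using mpolys_mono[of d "Suc d"] mpoly_var_in_mpolys unfolding poly_altdef polys_over_def
    by (auto intro!: sum_closed mult_closed power_closed)
qed

section \<open>The Nullstellensatz\<close>

text \<open>
  Induction on the number of variables: the constants of the prime ideal \<open>P\<close>, seen as an ideal of
  polynomials in the last variable, form a prime ideal in one variable fewer, and a zero of these
  constants at which \<open>u\<close> is nonzero extends to a zero of \<open>P\<close> at which \<open>p\<close> is nonzero.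
\<close>

lemma prime_in_mpolys_point:
  fixes P :: "'k::alg_closed_field mpoly set"
  assumes "prime_in (mpolys d) P" "p \<in> mpolys d" "p \<notin> P"
  shows "\<exists>a. (\<forall>g\<in>P. eval_at a g = 0) \<and> eval_at a p \<noteq> 0"
  using assms
proof (induction d arbitrary: P p)
  case 0
  have id: "ideal_in (mpolys 0) P"
    using 0(1) by (simp add: prime_in_def)
  have "eval_at (\<lambda>_. 0) g = 0" if "g \<in> P" for g
  proof -
    from that have "g \<in> mpolys 0"
      using ideal_inD(1)[OF id] by blast
    then obtain c where c: "g = Poly_Mapping.single 0 c"
      by (rule mpolys_0_eq_single)
    have "c = 0"
    proof (rule ccontr)
      assume "c \<noteq> 0"
      have "Poly_Mapping.single 0 (inverse c) * g \<in> P"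
        using that by (intro ideal_inD(4)[OF id] single_in_mpolys) auto
      also have "Poly_Mapping.single 0 (inverse c) * g = 1"
        using \<open>c \<noteq> 0\<close> by (simp add: c mult_single)
      finally show False
        using 0(1) by (simp add: prime_in_def)
    qed
    then show ?thesis
      by (simp add: c)
  qed
  moreover obtain c where c: "p = Poly_Mapping.single 0 c"
    using 0(2) by (rule mpolys_0_eq_single)
  moreover have "c \<noteq> 0"
    using 0(3) c ideal_inD(2)[OF id] by auto
  ultimately show ?case
    by (intro exI[of _ "\<lambda>_. 0"]) (simp add: eval_monom_def)
next
  case (Suc d)
  interpret coefficient_ring "mpolys d :: 'k mpoly set"
    by (rule coefficient_ring_mpolys)
  interpret SX: coefficient_ring "polys_over (mpolys d :: 'k mpoly set)"
    by (rule polys_over_coefficient_ring)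
  let ?x = "mpoly_var d :: 'k mpoly"
  have id: "ideal_in (mpolys (Suc d)) P"
    using Suc.prems(1) by (simp add: prime_in_def)
  have closed: "poly q ?x \<in> mpolys (Suc d)" if "q \<in> polys_over (mpolys d)" for q
    using that by (auto simp: mpolys_Suc_eq)
  define Q where "Q = {q \<in> polys_over (mpolys d). poly q ?x \<in> P}"
  have primeQ: "prime_in (polys_over (mpolys d)) Q"
    unfolding prime_in_def ideal_in_def
  proof (intro conjI ballI impI)
    show "1 \<notin> Q"
      using Suc.prems(1) by (simp add: Q_def prime_in_def)
    show "f \<in> Q \<or> g \<in> Q" if "f \<in> polys_over (mpolys d)" "g \<in> polys_over (mpolys d)" "f * g \<in> Q" for f g
      using that Suc.prems(1) closed by (auto simp: Q_def prime_in_def)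
  qed (use ideal_inD[OF id] SX.zero_closed SX.add_closed SX.mult_closed closed in \<open>auto simp: Q_def\<close>)
  obtain p' where p': "p' \<in> polys_over (mpolys d)" "p = poly p' ?x"
    using Suc.prems(2) by (auto simp: mpolys_Suc_eq)
  have "p' \<notin> Q"
    using p' Suc.prems(3) by (simp add: Q_def)
  from prime_point_extension[OF primeQ p'(1) this]
  obtain u where u: "u \<in> mpolys d" "[:u:] \<notin> Q"
    and extend: "\<And>\<phi> :: 'k mpoly \<Rightarrow> 'k. comm_ring_hom \<phi> \<Longrightarrow>
      (\<And>c. c \<in> mpolys d \<Longrightarrow> [:c:] \<in> Q \<Longrightarrow> \<phi> c = 0) \<Longrightarrow> \<phi> u \<noteq> 0 \<Longrightarrow>
      \<exists>b. (\<forall>g\<in>Q. poly (map_poly \<phi> g) b = 0) \<and> poly (map_poly \<phi> p') b \<noteq> 0"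
    by metis
  obtain a where a: "\<forall>g \<in> {c \<in> mpolys d. [:c:] \<in> Q}. eval_at a g = 0" "eval_at a u \<noteq> 0"
    using Suc.IH[OF prime_in_constants[OF primeQ] u(1)] u(2) by auto
  obtain b where b: "\<forall>g\<in>Q. poly (map_poly (eval_at a) g) b = 0" "poly (map_poly (eval_at a) p') b \<noteq> 0"
    using extend[OF eval_at.comm_ring_hom_axioms, of a] a by auto
  have eval: "eval_at (a(d := b)) (poly q ?x) = poly (map_poly (eval_at a) q) b"
    if q: "q \<in> polys_over (mpolys d)" for q
  proof -
    have "eval_at (a(d := b)) (poly q ?x) = poly (map_poly (eval_at (a(d := b))) q) b"
      using eval_at.poly_map_poly[of "a(d := b)" q ?x] by simp
    also have "map_poly (eval_at (a(d := b))) q = map_poly (eval_at a) q"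
      using q by (intro poly_eqI) (auto simp: polys_over_def intro: eval_at_cong)
    finally show ?thesis .
  qed
  have "eval_at (a(d := b)) g = 0" if "g \<in> P" for g
  proof -
    from that have "g \<in> mpolys (Suc d)"
      using ideal_inD(1)[OF id] by blast
    then obtain q where q: "q \<in> polys_over (mpolys d)" "g = poly q ?x"
      unfolding mpolys_Suc_eq by blast
    then show ?thesis
      using b(1) that by (simp add: eval Q_def)
  qed
  then show ?case
    using b(2) p' by (intro exI[of _ "a(d := b)"] conjI ballI) (simp_all add: eval del: fun_upd_apply)
qed

theorem nullstellensatz:
  fixes A :: "'k::alg_closed_field mpoly set"
  assumes "radical_in (mpolys d) A" "p \<in> mpolys d"
    and "\<And>a. (\<And>g. g \<in> A \<Longrightarrow> eval_at a g = 0) \<Longrightarrow> eval_at a p = 0"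
  shows "p \<in> A"
proof (rule ccontr)
  interpret coefficient_ring "mpolys d :: 'k mpoly set"
    by (rule coefficient_ring_mpolys)
  assume "p \<notin> A"
  then obtain P where "prime_in (mpolys d) P" "A \<subseteq> P" "p \<notin> P"
    using radical_in_imp_prime_avoiding assms(1,2) by blast
  then show False
    using prime_in_mpolys_point[of d P p] assms(2,3) by blast
qed

section \<open>Rows of polynomials and their values\<close>

text \<open>
  A row of length \<open>n\<close> is a function of which only the values below \<open>n\<close> matter. Rows thus add and
  scale pointwise.
\<close>

definition rows_over :: "'r set \<Rightarrow> nat \<Rightarrow> (nat \<Rightarrow> 'r) set" where
  "rows_over S n = {f. \<forall>j<n. f j \<in> S}"

definition row_submodule :: "'r::comm_ring_1 set \<Rightarrow> nat \<Rightarrow> (nat \<Rightarrow> 'r) set \<Rightarrow> bool" where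
  "row_submodule S n N \<longleftrightarrow> N \<subseteq> rows_over S n \<and> (\<lambda>_. 0) \<in> N \<and>
    (\<forall>f\<in>N. \<forall>g\<in>N. (\<lambda>i. f i + g i) \<in> N) \<and> (\<forall>s\<in>S. \<forall>f\<in>N. (\<lambda>i. s * f i) \<in> N)"

lemma row_submoduleD:
  assumes "row_submodule S n N"
  shows "N \<subseteq> rows_over S n" "(\<lambda>_. 0) \<in> N"
    "\<And>f g. f \<in> N \<Longrightarrow> g \<in> N \<Longrightarrow> (\<lambda>i. f i + g i) \<in> N"
    "\<And>s f. s \<in> S \<Longrightarrow> f \<in> N \<Longrightarrow> (\<lambda>i. s * f i) \<in> N"
  using assms by (simp_all add: row_submodule_def)

lemma (in coefficient_ring) row_submodule_diff:
  assumes N: "row_submodule S n N" and "f \<in> N" "g \<in> N"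
  shows "(\<lambda>i. f i - g i) \<in> N"
  using row_submoduleD(3)[OF N assms(2) row_submoduleD(4)[OF N uminus_closed[OF one_closed] assms(3)]]
  by simp

lemma (in coefficient_ring) row_submodule_sum:
  assumes N: "row_submodule S n N" and "\<And>k. k \<in> K \<Longrightarrow> s k \<in> S" "\<And>k. k \<in> K \<Longrightarrow> g k \<in> N"
  shows "(\<lambda>i. \<Sum>k\<in>K. s k * g k i) \<in> N"
  using assms(2,3)
proof (induction K rule: infinite_finite_induct)
  case (insert k K)
  have "(\<lambda>i. s k * g k i) \<in> N"
    using insert.prems by (intro row_submoduleD(4)[OF N]) auto
  then have "(\<lambda>i. s k * g k i + (\<Sum>k\<in>K. s k * g k i)) \<in> N"
    using insert by (intro row_submoduleD(3)[OF N]) auto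
  then show ?case
    using insert.hyps by simp
qed (use row_submoduleD(2)[OF N] in auto)

lemma row_submodule_Int:
  "row_submodule S n M \<Longrightarrow> row_submodule S n N \<Longrightarrow> row_submodule S n (M \<inter> N)"
  by (auto simp: row_submodule_def)

definition eval_row :: "nat \<Rightarrow> (nat \<Rightarrow> 'k::comm_ring_1) \<Rightarrow> (nat \<Rightarrow> 'k mpoly) \<Rightarrow> (nat \<Rightarrow> 'k) \<Rightarrow> 'k" where
  "eval_row n a f v = (\<Sum>j<n. eval_at a (f j) * v j)"

lemma eval_row_add: "eval_row n a (\<lambda>i. f i + g i) v = eval_row n a f v + eval_row n a g v"
  by (simp add: eval_row_def eval_at.hom_add distrib_right sum.distrib)

lemma eval_row_diff: "eval_row n a (\<lambda>i. f i - g i) v = eval_row n a f v - eval_row n a g v"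
  by (simp add: eval_row_def eval_at.hom_minus left_diff_distrib sum_subtractf)

lemma eval_row_smult: "eval_row n a (\<lambda>i. c * f i) v = eval_at a c * eval_row n a f v"
  by (simp add: eval_row_def eval_at.hom_mult sum_distrib_left mult.assoc)

lemma eval_row_unit: "j < n \<Longrightarrow> eval_row n a f (\<lambda>i. if i = j then 1 else 0) = eval_at a (f j)"
  by (simp add: eval_row_def if_distrib[of "\<lambda>x. _ * x"] sum.delta cong: if_cong)

lemma eval_row_update:
  assumes "j < n"
  shows "eval_row n a f (v(j := v j - t)) = eval_row n a f v - eval_at a (f j) * t"
proof -
  have "eval_at a (f i) * (v(j := v j - t)) i
      = eval_at a (f i) * v i - (if i = j then eval_at a (f j) * t else 0)" for i
    by (simp add: algebra_simps)
  then show ?thesis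
    using assms by (simp add: eval_row_def sum_subtractf sum.delta)
qed

text \<open>
  For \<open>Z = UNIV\<close> this is the vanishing condition of the theorem, one row at a time. Elimination
  weakens it to smaller sets \<open>Z\<close> of points, on which the pivots are invertible.
\<close>

definition vanishing_rows ::
  "nat \<Rightarrow> nat \<Rightarrow> (nat \<Rightarrow> 'k::comm_ring_1) set \<Rightarrow> (nat \<Rightarrow> 'k mpoly) set \<Rightarrow> (nat \<Rightarrow> 'k mpoly) set" where
  "vanishing_rows d n Z X = {f \<in> rows_over (mpolys d) n.
     \<forall>a\<in>Z. \<forall>v. (\<forall>g\<in>X. eval_row n a g v = 0) \<longrightarrow> eval_row n a f v = 0}"

lemma row_submodule_vanishing_rows: "row_submodule (mpolys d) n (vanishing_rows d n Z X)"
  unfolding row_submodule_def vanishing_rows_def rows_over_def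
  by (auto simp: eval_row_add eval_row_smult mpolys_add mpolys_mult eval_row_def[of _ _ "\<lambda>_. 0"])

lemma vanishing_rows_antimono: "Z \<subseteq> Z' \<Longrightarrow> vanishing_rows d n Z' X \<subseteq> vanishing_rows d n Z X"
  by (auto simp: vanishing_rows_def)

definition zeros_where :: "'k::comm_ring_1 mpoly set \<Rightarrow> 'k mpoly \<Rightarrow> (nat \<Rightarrow> 'k) set" where
  "zeros_where A e = {a. (\<forall>g\<in>A. eval_at a g = 0) \<and> eval_at a e \<noteq> 0}"

section \<open>Fraction-free elimination over a closed set\<close>

text \<open>
  Gaussian elimination on the rows \<open>X\<close> without division, over the part of the zero set of \<open>A\<close> where
  \<open>e\<close> does not vanish. A pivot \<open>c\<close> is an entry for which \<open>e * c\<close> is not in \<open>A\<close>; clearing its column by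
  \<open>g \<mapsto> c g - g\<^sub>j g\<^sub>0\<close> preserves the condition on the rows \<open>f\<close> where \<open>c\<close> is nonzero, so the recursion
  continues with \<open>e * c\<close> and fewer nonzero columns. If there is no pivot, all rows of \<open>X\<close> vanish on the set
  considered, hence so does \<open>f\<close>, and the Nullstellensatz puts the entries of \<open>e f\<close> into \<open>A\<close>.

  The factor \<open>e\<close> in the conclusion \<open>\<delta> * e \<notin> A\<close> keeps the product of all pivots outside \<open>A\<close>, which
  need not be prime.
\<close>

lemma radical_row_elimination:
  fixes A :: "'k::alg_closed_field mpoly set"
  assumes A: "radical_in (mpolys d) A"
    and N: "row_submodule (mpolys d) n N" and X: "X \<subseteq> N"
    and e: "e \<in> mpolys d" "e \<notin> A"
  shows "\<exists>\<delta>\<in>mpolys d. \<delta> * e \<notin> A \<and>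
    (\<forall>f \<in> vanishing_rows d n (zeros_where A e) X. \<exists>h\<in>N. \<forall>i<n. \<delta> * f i - h i \<in> A)"
  using X e
proof (induction "card {i. i < n \<and> (\<exists>g\<in>X. g i \<noteq> 0)}" arbitrary: X e rule: less_induct)
  case less
  interpret coefficient_ring "mpolys d :: 'k mpoly set"
    by (rule coefficient_ring_mpolys)
  have idA: "ideal_in (mpolys d) A"
    using A by (simp add: radical_in_def)
  note ND = row_submoduleD[OF N]
  let ?cols = "\<lambda>X. {i. i < n \<and> (\<exists>g\<in>X. g i \<noteq> 0)}"
  note e = less.prems(2,3)
  have XS: "g i \<in> mpolys d" if "g \<in> X" "i < n" for g i
    using that less.prems(1) ND(1) by (auto simp: rows_over_def)
  show ?case
  proof (cases "\<forall>g\<in>X. \<forall>i<n. e * g i \<in> A")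
    case True
    have "e * f i \<in> A" if f: "f \<in> vanishing_rows d n (zeros_where A e) X" and i: "i < n" for f i
    proof (rule nullstellensatz[OF A])
      show "e * f i \<in> mpolys d"
        using e(1) f i by (simp add: vanishing_rows_def rows_over_def mult_closed)
      fix a assume a: "\<And>g. g \<in> A \<Longrightarrow> eval_at a g = 0"
      show "eval_at a (e * f i) = 0"
      proof (cases "eval_at a e = 0")
        case False
        have "eval_at a (g j) = 0" if "g \<in> X" "j < n" for g j
          using a[of "e * g j"] True that False by (simp add: eval_at.hom_mult)
        then have "eval_row n a g v = 0" if "g \<in> X" for g v
          using that by (simp add: eval_row_def)
        then have "eval_row n a f (\<lambda>j. if j = i then 1 else 0) = 0"
          using f a False by (simp add: vanishing_rows_def zeros_where_def)
        then show ?thesis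
          using i by (simp add: eval_row_unit eval_at.hom_mult)
      qed (simp add: eval_at.hom_mult)
    qed
    moreover have "e * e \<notin> A"
      using A e by (auto simp: radical_in_def)
    ultimately show ?thesis
      using e(1) ND(2) by (intro bexI[of _ e] conjI ballI impI bexI[of _ "\<lambda>_. 0"]) auto
  next
    case False
    then obtain g\<^sub>0 j where g0: "g\<^sub>0 \<in> X" and j: "j < n" and ec: "e * g\<^sub>0 j \<notin> A"
      by blast
    define c where "c = g\<^sub>0 j"
    define elim where "elim = (\<lambda>g i. c * g i - g j * g\<^sub>0 i)"
    have c: "c \<in> mpolys d"
      using XS g0 j by (simp add: c_def)
    have elim_N: "elim g \<in> N" if "g \<in> N" for g
      unfolding elim_def using that less.prems(1) g0 c ND(1) j
      by (intro row_submodule_diff[OF N] ND(4)) (auto simp: rows_over_def)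
    have eval_elim: "eval_row n a (elim g) v
        = eval_at a c * eval_row n a g v - eval_at a (g j) * eval_row n a g\<^sub>0 v" for a g v
      by (simp add: elim_def eval_row_diff eval_row_smult)
    have "?cols (elim ` X) \<subset> ?cols X"
    proof
      show "?cols (elim ` X) \<subseteq> ?cols X"
        using g0 unfolding elim_def by (auto, metis mult_zero_right)
      have "g\<^sub>0 j \<noteq> 0"
        using ec ideal_inD(2)[OF idA] by auto
      then have "j \<in> ?cols X"
        using g0 j by blast
      moreover have "j \<notin> ?cols (elim ` X)"
        by (auto simp: elim_def c_def)
      ultimately show "?cols (elim ` X) \<noteq> ?cols X"
        by blast
    qed
    then have "card (?cols (elim ` X)) < card (?cols X)"
      by (intro psubset_card_mono) auto
    moreover have "elim ` X \<subseteq> N"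
      using elim_N less.prems(1) by blast
    ultimately have "\<exists>\<delta>\<in>mpolys d. \<delta> * (e * c) \<notin> A \<and>
        (\<forall>f \<in> vanishing_rows d n (zeros_where A (e * c)) (elim ` X). \<exists>h\<in>N. \<forall>i<n. \<delta> * f i - h i \<in> A)"
      using mult_closed[OF e(1) c] ec unfolding c_def by (rule less.hyps)
    then obtain \<delta> where \<delta>: "\<delta> \<in> mpolys d" "\<delta> * (e * c) \<notin> A"
      and solve: "\<And>f. f \<in> vanishing_rows d n (zeros_where A (e * c)) (elim ` X) \<Longrightarrow>
        \<exists>h\<in>N. \<forall>i<n. \<delta> * f i - h i \<in> A"
      by blast
    have "\<exists>h\<in>N. \<forall>i<n. (\<delta> * c) * f i - h i \<in> A"
      if f: "f \<in> vanishing_rows d n (zeros_where A e) X" for f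
    proof -
      have f_entry: "f i \<in> mpolys d" if "i < n" for i
        using f that by (simp add: vanishing_rows_def rows_over_def)
      have "elim f \<in> vanishing_rows d n (zeros_where A (e * c)) (elim ` X)"
        unfolding vanishing_rows_def
      proof (intro CollectI conjI ballI allI impI)
        show "elim f \<in> rows_over (mpolys d) n"
          using f_entry c XS[OF g0] j by (auto simp: rows_over_def elim_def intro!: diff_closed mult_closed)
        fix a v
        assume a: "a \<in> zeros_where A (e * c)" and kill: "\<forall>g\<in>elim ` X. eval_row n a g v = 0"
        \<comment> \<open>Changing the pivot coordinate of \<open>v\<close> gives a vector killed by \<open>g\<^sub>0\<close>, on which
          \<open>c g\<close> takes the value that the reduced row takes on \<open>v\<close>.\<close>
        define t where "t = eval_row n a g\<^sub>0 v / eval_at a c"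
        define w where "w = v(j := v j - t)"
        have ca: "eval_at a e \<noteq> 0" "eval_at a c \<noteq> 0"
          using a by (auto simp: zeros_where_def eval_at.hom_mult)
        have w: "eval_at a c * eval_row n a g w = eval_row n a (elim g) v" for g
          using ca(2) j by (simp add: w_def eval_row_update eval_elim t_def right_diff_distrib)
        have "eval_row n a g w = 0" if "g \<in> X" for g
          using w[of g] kill that ca(2) by simp
        then have "eval_row n a f w = 0"
          using f a ca(1) by (simp add: vanishing_rows_def zeros_where_def)
        then show "eval_row n a (elim f) v = 0"
          using w[of f] by simp
      qed
      then obtain h where h: "h \<in> N" "\<forall>i<n. \<delta> * elim f i - h i \<in> A"
        using solve by blast
      have "(\<lambda>i. h i + (\<delta> * f j) * g\<^sub>0 i) \<in> N"
        using h(1) \<delta>(1) f_entry j g0 less.prems(1)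
        by (intro ND(3,4) mult_closed) auto
      moreover have "(\<delta> * c) * f i - (h i + (\<delta> * f j) * g\<^sub>0 i) = \<delta> * elim f i - h i" for i
        by (simp add: elim_def algebra_simps)
      ultimately show ?thesis
        using h(2) by (intro bexI[of _ "\<lambda>i. h i + (\<delta> * f j) * g\<^sub>0 i"] allI impI) (simp_all only:)
    qed
    moreover have "\<delta> * c * e \<notin> A"
      using \<delta>(2) by (simp add: mult_ac)
    ultimately show ?thesis
      using mult_closed[OF \<delta>(1) c] by (intro bexI[of _ "\<delta> * c"] conjI ballI impI)
  qed
qed

section \<open>Semiprime modules of rows\<close>

text \<open>
  The ideal \<open>A\<close> below is the conductor of \<open>M\<close> into \<open>N\<close>. The combination \<open>h\<close> of rows has to be found in
  \<open>N \<inter> M\<close> and not just in \<open>N\<close>, so that the error row \<open>r\<close> is again in \<open>M\<close>, where \<open>A\<close> acts.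
\<close>

theorem semiprime_row_nullstellensatz:
  fixes N X :: "(nat \<Rightarrow> 'k::alg_closed_field mpoly) set"
  assumes N: "row_submodule (mpolys d) n N"
    and semiprime: "\<And>f. f \<in> rows_over (mpolys d) n \<Longrightarrow> (\<And>j. j < n \<Longrightarrow> (\<lambda>i. f j * f i) \<in> N) \<Longrightarrow> f \<in> N"
    and X: "X \<subseteq> N"
  shows "vanishing_rows d n UNIV X \<subseteq> N"
proof -
  interpret coefficient_ring "mpolys d :: 'k mpoly set"
    by (rule coefficient_ring_mpolys)
  define M where "M = vanishing_rows d n UNIV X"
  have M: "row_submodule (mpolys d) n M"
    unfolding M_def by (rule row_submodule_vanishing_rows)
  note ND = row_submoduleD[OF N] and MD = row_submoduleD[OF M]
  have M_entry: "f j \<in> mpolys d" if "f \<in> M" "j < n" for f j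
    using that MD(1) by (auto simp: rows_over_def)
  define A where "A = {p \<in> mpolys d. \<forall>f\<in>M. (\<lambda>i. p * f i) \<in> N}"
  have "ideal_in (mpolys d) A"
    unfolding ideal_in_def
  proof (intro conjI ballI)
    show "p + q \<in> A" if "p \<in> A" "q \<in> A" for p q
      using that ND(3)[of "\<lambda>i. p * _ i" "\<lambda>i. q * _ i"] by (auto simp: A_def add_closed distrib_right)
    show "s * p \<in> A" if "s \<in> mpolys d" "p \<in> A" for s p
      using that ND(4)[of s "\<lambda>i. p * _ i"] by (auto simp: A_def mult_closed mult.assoc)
  qed (use ND(2) in \<open>auto simp: A_def\<close>)
  moreover have "p \<in> A" if p: "p \<in> mpolys d" "p * p \<in> A" for p
  proof -
    have "(\<lambda>i. p * f i) \<in> N" if f: "f \<in> M" for f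
    proof (rule semiprime)
      show "(\<lambda>i. p * f i) \<in> rows_over (mpolys d) n"
        using f p(1) M_entry by (simp add: rows_over_def mult_closed)
      fix j assume "j < n"
      then have "(\<lambda>i. f j * f i) \<in> M"
        using f M_entry by (intro MD(4))
      then have "(\<lambda>i. p * p * (f j * f i)) \<in> N"
        using p(2) by (simp add: A_def)
      then show "(\<lambda>i. (p * f j) * (p * f i)) \<in> N"
        by (simp add: mult_ac)
    qed
    then show ?thesis
      using p(1) by (simp add: A_def)
  qed
  ultimately have A: "radical_in (mpolys d) A"
    by (simp add: radical_in_def)
  have XM: "X \<subseteq> N \<inter> M"
    using X ND(1) by (auto simp: M_def vanishing_rows_def)
  have "1 \<in> A"
  proof (rule ccontr)
    assume "1 \<notin> A"
    then obtain \<delta> where \<delta>: "\<delta> \<in> mpolys d" "\<delta> \<notin> A"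
      and solve: "\<And>f. f \<in> vanishing_rows d n (zeros_where A 1) X \<Longrightarrow>
        \<exists>h\<in>N \<inter> M. \<forall>i<n. \<delta> * f i - h i \<in> A"
      using radical_row_elimination[OF A row_submodule_Int[OF N M] XM one_closed] by auto
    have "(\<lambda>i. \<delta> * f i) \<in> N" if f: "f \<in> M" for f
    proof -
      obtain h where h: "h \<in> N" "h \<in> M" "\<And>i. i < n \<Longrightarrow> \<delta> * f i - h i \<in> A"
        using solve[of f] f vanishing_rows_antimono[OF subset_UNIV] unfolding M_def by blast
      define r where "r = (\<lambda>i. \<delta> * f i - h i)"
      have "r \<in> M"
        unfolding r_def using f h(2) \<delta>(1) by (intro row_submodule_diff[OF M] MD(4))
      have "r \<in> N"
      proof (rule semiprime)
        show "r \<in> rows_over (mpolys d) n"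
          using \<open>r \<in> M\<close> MD(1) by blast
        fix j assume "j < n"
        then have "r j \<in> A"
          using h(3) by (simp add: r_def)
        then show "(\<lambda>i. r j * r i) \<in> N"
          using \<open>r \<in> M\<close> by (simp add: A_def)
      qed
      then have "(\<lambda>i. r i + h i) \<in> N"
        using h(1) by (rule ND(3))
      then show ?thesis
        by (simp add: r_def)
    qed
    then show False
      using \<delta> by (simp add: A_def)
  qed
  then show ?thesis
    by (auto simp: A_def M_def)
qed

section \<open>Left ideals of matrices and modules of rows\<close>

lemma mpoly_mat_ring_simps:
  "carrier (mpoly_mat_ring d n) = mpoly_mats d n"
  "mult (mpoly_mat_ring d n :: 'k::comm_ring_1 mpoly mat ring) = (*)"
  "add (mpoly_mat_ring d n :: 'k mpoly mat ring) = (+)"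
  "zero (mpoly_mat_ring d n :: 'k mpoly mat ring) = 0\<^sub>m n n"
  by (simp_all add: mpoly_mat_ring_def ring_mat_def)

lemma left_idealI:
  assumes "ring S" and sub: "I \<subseteq> carrier S" and zero: "\<zero>\<^bsub>S\<^esub> \<in> I"
    and add: "\<And>x y. x \<in> I \<Longrightarrow> y \<in> I \<Longrightarrow> x \<oplus>\<^bsub>S\<^esub> y \<in> I"
    and mult: "\<And>s x. s \<in> carrier S \<Longrightarrow> x \<in> I \<Longrightarrow> s \<otimes>\<^bsub>S\<^esub> x \<in> I"
  shows "left_ideal I S"
proof -
  interpret ring S by fact
  have "\<ominus>\<^bsub>S\<^esub> x \<in> I" if "x \<in> I" for x
    using mult[of "\<ominus>\<^bsub>S\<^esub> \<one>\<^bsub>S\<^esub>" x] that sub l_minus[of "\<one>\<^bsub>S\<^esub>" x] by auto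
  then have "subgroup I (add_monoid S)"
    using sub zero add by (intro add.subgroupI) (auto simp: a_inv_def)
  then show ?thesis
    by (intro left_ideal.intro left_ideal_axioms.intro additive_subgroupI ring_axioms mult)
qed

definition mat_row :: "'a mat \<Rightarrow> nat \<Rightarrow> nat \<Rightarrow> 'a" where
  "mat_row B i = (\<lambda>j. B $$ (i, j))"

lemma mat_row_in_rows_over: "B \<in> mpoly_mats d n \<Longrightarrow> i < n \<Longrightarrow> mat_row B i \<in> rows_over (mpolys d) n"
  by (simp add: mat_row_def mpoly_mats_def rows_over_def)

lemma mat_mult_entry:
  assumes "A \<in> carrier_mat n n" "B \<in> carrier_mat n n" "i < n" "j < n"
  shows "(A * B) $$ (i, j) = (\<Sum>k<n. A $$ (i, k) * B $$ (k, j))"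
  using assms by (simp add: scalar_prod_def atLeast0LessThan)

lemma eval_mat_mult_vec_eq_0_iff:
  assumes "B \<in> carrier_mat n n" "v \<in> carrier_vec n"
  shows "eval_mat a B *\<^sub>v v = 0\<^sub>v n \<longleftrightarrow> (\<forall>i<n. eval_row n (\<lambda>i. a $ i) (mat_row B i) (\<lambda>j. v $ j) = 0)"
proof -
  have "(eval_mat a B *\<^sub>v v) $ i = eval_row n (\<lambda>i. a $ i) (mat_row B i) (\<lambda>j. v $ j)" if "i < n" for i
    using assms that
    by (simp add: eval_mat_def eval_row_def mat_row_def eval_mpoly_eq_eval_at scalar_prod_def atLeast0LessThan)
  moreover have "eval_mat a B *\<^sub>v v \<in> carrier_vec n"
    using assms by (intro mult_mat_vec_carrier[of _ n n]) (simp_all add: eval_mat_def)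
  ultimately show ?thesis
    using carrier_vecD[of "eval_mat a B *\<^sub>v v" n]
    by (auto simp: vec_eq_iff simp del: index_mult_mat_vec dim_mult_mat_vec)
qed

lemma eval_row_mat_mult:
  assumes "A \<in> carrier_mat n n" "B \<in> carrier_mat n n" "i < n"
  shows "eval_row n a (mat_row (A * B) i) v = (\<Sum>k<n. eval_at a (A $$ (i, k)) * eval_row n a (mat_row B k) v)"
proof -
  have "eval_row n a (mat_row (A * B) i) v = (\<Sum>j<n. \<Sum>k<n. eval_at a (A $$ (i, k)) * (eval_at a (B $$ (k, j)) * v j))"
    using assms
    by (simp add: eval_row_def mat_row_def mat_mult_entry eval_at.hom_sum eval_at.hom_mult
        sum_distrib_right mult.assoc del: index_mult_mat)
  also have "\<dots> = (\<Sum>k<n. eval_at a (A $$ (i, k)) * eval_row n a (mat_row B k) v)"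
    by (subst sum.swap) (simp add: eval_row_def mat_row_def sum_distrib_left)
  finally show ?thesis .
qed

definition elementary_mat :: "nat \<Rightarrow> nat \<Rightarrow> nat \<Rightarrow> 'a::zero \<Rightarrow> 'a mat" where
  "elementary_mat n p q s = mat n n (\<lambda>(i, j). if i = p \<and> j = q then s else 0)"

lemma elementary_mat_dims [simp]:
  "elementary_mat n p q s \<in> carrier_mat n n"
  "dim_row (elementary_mat n p q s) = n" "dim_col (elementary_mat n p q s) = n"
  by (simp_all add: elementary_mat_def)

lemma elementary_mat_in_mpoly_mats: "s \<in> mpolys d \<Longrightarrow> elementary_mat n p q s \<in> mpoly_mats d n"
  by (simp add: elementary_mat_def mpoly_mats_def)

lemma elementary_mat_mult_entry:
  fixes B :: "'a::comm_ring_1 mat"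
  assumes "B \<in> carrier_mat n n" "i < n" "j < n" "q < n"
  shows "(elementary_mat n p q s * B) $$ (i, j) = (if i = p then s * B $$ (q, j) else 0)"
proof -
  have "(elementary_mat n p q s * B) $$ (i, j)
      = (\<Sum>k<n. if k = q then (if i = p then s * B $$ (q, j) else 0) else 0)"
    unfolding mat_mult_entry[OF elementary_mat_dims(1) assms(1-3)]
    using assms by (intro sum.cong) (auto simp: elementary_mat_def)
  then show ?thesis
    using assms(4) by simp
qed

text \<open>
  With \<open>w = x(a)v\<close>, the entry \<open>k\<close> of \<open>x(a) E\<^sub>p\<^sub>k w\<close> is \<open>x\<^sub>k\<^sub>p(a) w\<^sub>k\<close>. If these products vanish for all \<open>p\<close> and
  \<open>w\<^sub>k \<noteq> 0\<close>, then row \<open>k\<close> of \<open>x(a)\<close> is zero, and \<open>w\<^sub>k = 0\<close> after all.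
\<close>

lemma semiprime_left_ideal_killing_vector:
  fixes a v :: "nat \<Rightarrow> 'k::field" and d n :: nat
  defines "J \<equiv> {B \<in> mpoly_mats d n. \<forall>i<n. eval_row n a (mat_row B i) v = 0}"
  shows "semiprime_left_ideal J (mpoly_mat_ring d n)"
proof -
  let ?S = "mpoly_mat_ring d n :: 'k mpoly mat ring"
  interpret ring ?S
    by (rule ring_mpoly_mat_ring)
  have carrier: "B \<in> carrier_mat n n" if "B \<in> mpoly_mats d n" for B :: "'k mpoly mat"
    using that by (simp add: mpoly_mats_def)
  have "left_ideal J ?S"
  proof (rule left_idealI[OF ring_axioms])
    show "\<zero>\<^bsub>?S\<^esub> \<in> J"
      using zero_closed
      by (auto simp: J_def mpoly_mat_ring_simps eval_row_def mat_row_def)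
    show "x \<oplus>\<^bsub>?S\<^esub> y \<in> J" if "x \<in> J" "y \<in> J" for x y
    proof -
      have xy: "x \<in> carrier_mat n n" "y \<in> carrier_mat n n" "x \<in> mpoly_mats d n" "y \<in> mpoly_mats d n"
        using that carrier by (auto simp: J_def)
      have "eval_row n a (mat_row (x + y) i) v = eval_row n a (mat_row x i) v + eval_row n a (mat_row y i) v"
        if "i < n" for i
        using xy(1,2) that
        by (simp add: eval_row_def mat_row_def eval_at.hom_add distrib_right sum.distrib)
      moreover have "x + y \<in> mpoly_mats d n"
        using add.m_closed xy(3,4) by (simp add: mpoly_mat_ring_simps)
      ultimately show ?thesis
        using that by (simp add: J_def mpoly_mat_ring_simps)
    qed
    show "s \<otimes>\<^bsub>?S\<^esub> x \<in> J" if "s \<in> carrier ?S" "x \<in> J" for s x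
    proof -
      have "s * x \<in> mpoly_mats d n"
        using m_closed[of s x] that by (auto simp: mpoly_mat_ring_simps J_def)
      moreover have "s \<in> carrier_mat n n" "x \<in> carrier_mat n n"
        using that carrier by (auto simp: J_def mpoly_mat_ring_simps)
      ultimately show ?thesis
        using that(2) by (simp add: J_def mpoly_mat_ring_simps eval_row_mat_mult)
    qed
  qed (auto simp: J_def mpoly_mat_ring_simps)
  moreover have "x \<in> J"
    if x: "x \<in> carrier ?S" and sand: "\<forall>s\<in>carrier ?S. x \<otimes>\<^bsub>?S\<^esub> s \<otimes>\<^bsub>?S\<^esub> x \<in> J" for x
  proof (rule ccontr)
    assume "x \<notin> J"
    then obtain k where k: "k < n" "eval_row n a (mat_row x k) v \<noteq> 0"
      using x by (auto simp: J_def mpoly_mat_ring_simps)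
    have xM: "x \<in> carrier_mat n n"
      using x carrier by (simp add: mpoly_mat_ring_simps)
    have "eval_at a (x $$ (k, p)) = 0" if p: "p < n" for p
    proof -
      let ?E = "elementary_mat n p k (1 :: 'k mpoly)"
      have E: "?E \<in> mpoly_mats d n"
        by (intro elementary_mat_in_mpoly_mats) simp
      have "x * ?E * x = x * (?E * x)"
        using xM carrier[OF E] by (intro assoc_mult_mat)
      moreover have "eval_row n a (mat_row (x * (?E * x)) k) v
          = (\<Sum>l<n. eval_at a (x $$ (k, l)) * (if l = p then eval_row n a (mat_row x k) v else 0))"
      proof (subst eval_row_mat_mult)
        have "eval_row n a (mat_row (?E * x) l) v = (if l = p then eval_row n a (mat_row x k) v else 0)"
          if "l < n" for l
          unfolding eval_row_def mat_row_def using that k(1) xM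
          by (auto simp: elementary_mat_mult_entry simp del: index_mult_mat)
        then show "(\<Sum>l<n. eval_at a (x $$ (k, l)) * eval_row n a (mat_row (?E * x) l) v)
            = (\<Sum>l<n. eval_at a (x $$ (k, l)) * (if l = p then eval_row n a (mat_row x k) v else 0))"
          by simp
      qed (use xM carrier[OF E] k(1) in auto)
      moreover have "eval_row n a (mat_row (x * ?E * x) k) v = 0"
        using sand E k(1) by (simp add: mpoly_mat_ring_simps J_def)
      ultimately show ?thesis
        using k(2) p by (simp add: if_distrib[of "\<lambda>y. _ * y"] cong: if_cong)
    qed
    then have "eval_row n a (mat_row x k) v = 0"
      by (simp add: eval_row_def mat_row_def)
    with k(2) show False
      by contradiction
  qed
  ultimately show ?thesis
    by (intro semiprime_left_ideal.intro semiprime_left_ideal_axioms.intro)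
qed

definition first_row_mat :: "nat \<Rightarrow> (nat \<Rightarrow> 'a::zero) \<Rightarrow> 'a mat" where
  "first_row_mat n f = mat n n (\<lambda>(i, j). if i = 0 then f j else 0)"

lemma first_row_mat_dims [simp]:
  "first_row_mat n f \<in> carrier_mat n n"
  "dim_row (first_row_mat n f) = n" "dim_col (first_row_mat n f) = n"
  by (simp_all add: first_row_mat_def)

lemma first_row_mat_entry [simp]:
  "i < n \<Longrightarrow> j < n \<Longrightarrow> first_row_mat n f $$ (i, j) = (if i = 0 then f j else 0)"
  by (simp add: first_row_mat_def)

lemma first_row_mat_in_mpoly_mats:
  "f \<in> rows_over (mpolys d) n \<Longrightarrow> first_row_mat n f \<in> mpoly_mats d n"
  by (simp add: first_row_mat_def mpoly_mats_def rows_over_def)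

text \<open>
  Rows are moved in and out of position \<open>0\<close> by elementary matrices acting from the left, so a matrix
  lies in \<open>I\<close> if and only if each of its rows, placed in position \<open>0\<close>, gives a matrix in \<open>I\<close>. For a matrix \<open>x\<close>
  with single row \<open>f\<close>, the product \<open>x s x\<close> has single row \<open>(\<Sum>k. s\<^sub>k\<^sub>0 f\<^sub>k) f\<close>, which turns
  semiprimeness of \<open>I\<close> into the condition on rows.
\<close>

theorem vanishing_matrix_in_semiprime_left_ideal:
  fixes B :: "'k::alg_closed_field mpoly mat"
  assumes n: "n > 0"
    and I: "semiprime_left_ideal I (mpoly_mat_ring d n)"
    and \<G>: "\<G> \<subseteq> I"
    and B: "B \<in> mpoly_mats d n"
    and vanish: "\<And>i. i < n \<Longrightarrow> mat_row B i \<in> vanishing_rows d n UNIV {mat_row A k |A k. A \<in> \<G> \<and> k < n}"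
  shows "B \<in> I"
proof -
  let ?S = "mpoly_mat_ring d n :: 'k mpoly mat ring"
  interpret coefficient_ring "mpolys d :: 'k mpoly set"
    by (rule coefficient_ring_mpolys)
  interpret I: semiprime_left_ideal I ?S
    by fact
  have IS: "A \<in> mpoly_mats d n" if "A \<in> I" for A
    using I.a_subset that by (auto simp: mpoly_mat_ring_simps)
  have carrier: "A \<in> carrier_mat n n" if "A \<in> mpoly_mats d n" for A :: "'k mpoly mat"
    using that by (simp add: mpoly_mats_def)
  have I_zero: "0\<^sub>m n n \<in> I" and I_add: "\<And>A C. A \<in> I \<Longrightarrow> C \<in> I \<Longrightarrow> A + C \<in> I"
    and I_mult: "\<And>A C. A \<in> mpoly_mats d n \<Longrightarrow> C \<in> I \<Longrightarrow> A * C \<in> I"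
    using additive_subgroup.zero_closed[OF I.additive_subgroup_axioms]
      additive_subgroup.a_closed[OF I.additive_subgroup_axioms] I.l_closed by (auto simp: mpoly_mat_ring_simps)
  define N where "N = {f \<in> rows_over (mpolys d) n. first_row_mat n f \<in> I}"
  have N: "row_submodule (mpolys d) n N"
    unfolding row_submodule_def
  proof (intro conjI ballI)
    have "first_row_mat n (\<lambda>_. 0) = (0\<^sub>m n n :: 'k mpoly mat)"
      by (rule eq_matI) (auto simp: first_row_mat_def)
    then show "(\<lambda>_. 0) \<in> N"
      using I_zero by (simp add: N_def rows_over_def)
    show "(\<lambda>i. f i + g i) \<in> N" if fg: "f \<in> N" "g \<in> N" for f g
    proof -
      have "first_row_mat n (\<lambda>i. f i + g i) = first_row_mat n f + first_row_mat n g"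
        by (rule eq_matI) (auto simp: first_row_mat_def)
      then show ?thesis
        using fg I_add by (simp add: N_def rows_over_def add_closed)
    qed
    show "(\<lambda>i. s * f i) \<in> N" if s: "s \<in> mpolys d" and f: "f \<in> N" for s f
    proof -
      have "first_row_mat n (\<lambda>i. s * f i) = elementary_mat n 0 0 s * first_row_mat n f"
        using n by (intro eq_matI) (simp_all add: elementary_mat_mult_entry del: index_mult_mat(1))
      then show ?thesis
        using f s I_mult[OF elementary_mat_in_mpoly_mats[OF s]] by (simp add: N_def rows_over_def mult_closed)
    qed
  qed (simp add: N_def)
  have semiprime: "f \<in> N" if f: "f \<in> rows_over (mpolys d) n" and sq: "\<And>j. j < n \<Longrightarrow> (\<lambda>i. f j * f i) \<in> N" for f
  proof -
    let ?f = "first_row_mat n f"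
    have fM: "?f \<in> mpoly_mats d n"
      using f by (rule first_row_mat_in_mpoly_mats)
    have "?f * s * ?f \<in> I" if s: "s \<in> mpoly_mats d n" for s
    proof -
      have entry: "(?f * s) $$ (i, 0) = (if i = 0 then \<Sum>k<n. f k * s $$ (k, 0) else 0)" if "i < n" for i
        using that n carrier[OF fM] carrier[OF s]
        by (simp add: mat_mult_entry[of _ n] del: index_mult_mat(1))
      have "?f * s * ?f = first_row_mat n (\<lambda>j. \<Sum>k<n. s $$ (k, 0) * (f k * f j))"
      proof (rule eq_matI)
        fix i j assume "i < dim_row (first_row_mat n (\<lambda>j. \<Sum>k<n. s $$ (k, 0) * (f k * f j)))"
          "j < dim_col (first_row_mat n (\<lambda>j. \<Sum>k<n. s $$ (k, 0) * (f k * f j)))"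
        then have ij: "i < n" "j < n"
          by simp_all
        have "(?f * s * ?f) $$ (i, j) = (\<Sum>l<n. (?f * s) $$ (i, l) * ?f $$ (l, j))"
          using carrier[OF fM] carrier[OF s] ij by (intro mat_mult_entry) auto
        also have "\<dots> = (\<Sum>l<n. if l = 0 then (?f * s) $$ (i, 0) * f j else 0)"
          using ij by (intro sum.cong) auto
        also have "\<dots> = (if i = 0 then \<Sum>k<n. s $$ (k, 0) * (f k * f j) else 0)"
          using n ij by (simp add: entry sum_distrib_left sum_distrib_right mult_ac)
        finally show "(?f * s * ?f) $$ (i, j) = first_row_mat n (\<lambda>j. \<Sum>k<n. s $$ (k, 0) * (f k * f j)) $$ (i, j)"
          using ij by simp
      qed (use carrier[OF fM] in simp_all)
      moreover have "(\<lambda>j. \<Sum>k<n. s $$ (k, 0) * (f k * f j)) \<in> N"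
        using s n sq by (intro row_submodule_sum[OF N, of _ _ "\<lambda>k i. f k * f i"]) (auto simp: mpoly_mats_def)
      ultimately show ?thesis
        by (simp add: N_def)
    qed
    then have "?f \<in> I"
      using fM by (intro I.semiprime) (auto simp: mpoly_mat_ring_simps)
    then show ?thesis
      using f by (simp add: N_def)
  qed
  have "mat_row A k \<in> N" if A: "A \<in> \<G>" and k: "k < n" for A k
  proof -
    have AI: "A \<in> I"
      using A \<G> by blast
    have "first_row_mat n (mat_row A k) = elementary_mat n 0 k 1 * A"
      using k carrier[OF IS[OF AI]] by (intro eq_matI)
        (simp_all add: elementary_mat_mult_entry mat_row_def del: index_mult_mat(1))
    then show ?thesis
      using I_mult[OF elementary_mat_in_mpoly_mats AI] mat_row_in_rows_over[OF IS[OF AI] k]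
      by (simp add: N_def)
  qed
  then have "{mat_row A k |A k. A \<in> \<G> \<and> k < n} \<subseteq> N"
    by blast
  from semiprime_row_nullstellensatz[OF N semiprime this]
  have rows: "first_row_mat n (mat_row B i) \<in> I" if "i < n" for i
    using vanish[OF that] by (auto simp: N_def)
  \<comment> \<open>The rows of \<open>B\<close> are assembled one at a time.\<close>
  have "mat n n (\<lambda>(i, j). if i < r then B $$ (i, j) else 0) \<in> I" if "r \<le> n" for r
    using that
  proof (induction r)
    case 0
    have "mat n n (\<lambda>(i, j). if i < (0::nat) then B $$ (i, j) else 0) = 0\<^sub>m n n"
      by (rule eq_matI) auto
    then show ?case
      using I_zero by (simp only:)
  next
    case (Suc r)
    have "mat n n (\<lambda>(i, j). if i < Suc r then B $$ (i, j) else 0)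
        = mat n n (\<lambda>(i, j). if i < r then B $$ (i, j) else 0)
          + elementary_mat n r 0 1 * first_row_mat n (mat_row B r)"
      using n Suc.prems by (intro eq_matI)
        (auto simp: elementary_mat_mult_entry mat_row_def less_Suc_eq simp del: index_mult_mat(1))
    then show ?case
      using Suc rows[of r] by (auto intro!: I_add I_mult elementary_mat_in_mpoly_mats)
  qed
  from this[of n] have "mat n n (\<lambda>(i, j). if i < n then B $$ (i, j) else 0) \<in> I"
    by simp
  also have "mat n n (\<lambda>(i, j). if i < n then B $$ (i, j) else 0) = B"
    using carrier[OF B] by (intro eq_matI) auto
  finally show ?thesis .
qed

section \<open>The Nullstellensatz for matrices of polynomials\<close>

theorem theorem4:
  fixes d n m :: nat
    and G :: "nat \<Rightarrow> 'k::alg_closed_field mpoly mat"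
    and F :: "'k mpoly mat"
  assumes "n > 0"
    and "\<And>i. i \<in> {1..m} \<Longrightarrow> G i \<in> carrier (mpoly_mat_ring d n)"
    and "F \<in> carrier (mpoly_mat_ring d n)"
  shows "F \<in> semiprime_left_ideal_gen (mpoly_mat_ring d n) (G ` {1..m}) \<longleftrightarrow>
    (\<forall>a \<in> carrier_vec d. \<forall>v \<in> carrier_vec n.
       (\<forall>i \<in> {1..m}. eval_mat a (G i) *\<^sub>v v = 0\<^sub>v n) \<longrightarrow> eval_mat a F *\<^sub>v v = 0\<^sub>v n)"
proof -
  let ?S = "mpoly_mat_ring d n :: 'k mpoly mat ring"
  have G: "G i \<in> mpoly_mats d n" if "i \<in> {1..m}" for i
    using assms(2) that by (simp add: mpoly_mat_ring_simps)
  have F: "F \<in> mpoly_mats d n"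
    using assms(3) by (simp add: mpoly_mat_ring_simps)
  have carrier: "A \<in> carrier_mat n n" if "A \<in> mpoly_mats d n" for A :: "'k mpoly mat"
    using that by (simp add: mpoly_mats_def)
  have gen: "semiprime_left_ideal_gen ?S (G ` {1..m})
      = \<Inter>{I. semiprime_left_ideal I ?S \<and> G ` {1..m} \<subseteq> I}"
    using assms(2) by (intro semiprime_left_ideal_gen_eq_Inter ring_mpoly_mat_ring) auto
  show ?thesis
  proof (intro iffI ballI impI)
    fix a v
    assume mem: "F \<in> semiprime_left_ideal_gen ?S (G ` {1..m})"
      and v: "v \<in> carrier_vec n" and zero: "\<forall>i\<in>{1..m}. eval_mat a (G i) *\<^sub>v v = 0\<^sub>v n"
    let ?J = "{B \<in> mpoly_mats d n. \<forall>i<n. eval_row n (\<lambda>i. a $ i) (mat_row B i) (\<lambda>j. v $ j) = 0}"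
    have "G ` {1..m} \<subseteq> ?J"
      using G carrier zero v by (auto simp: eval_mat_mult_vec_eq_0_iff)
    then have "F \<in> ?J"
      using mem semiprime_left_ideal_killing_vector unfolding gen by blast
    then show "eval_mat a F *\<^sub>v v = 0\<^sub>v n"
      using carrier[OF F] v by (simp add: eval_mat_mult_vec_eq_0_iff)
  next
    assume vanish: "\<forall>a\<in>carrier_vec d. \<forall>v\<in>carrier_vec n.
      (\<forall>i\<in>{1..m}. eval_mat a (G i) *\<^sub>v v = 0\<^sub>v n) \<longrightarrow> eval_mat a F *\<^sub>v v = 0\<^sub>v n"
    let ?X = "{mat_row A k |A k. A \<in> G ` {1..m} \<and> k < n}"
    have eval_vec: "eval_row n (\<lambda>i. vec d a $ i) (mat_row A k) (\<lambda>j. vec n v $ j) = eval_row n a (mat_row A k) v"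
      if "A \<in> mpoly_mats d n" "k < n" for A k and a v :: "nat \<Rightarrow> 'k"
      unfolding eval_row_def using that
      by (intro sum.cong arg_cong2[of _ _ _ _ "(*)"] eval_at_cong[of _ d]) (auto simp: mat_row_def mpoly_mats_def)
    have "mat_row F k \<in> vanishing_rows d n UNIV ?X" if k: "k < n" for k
      unfolding vanishing_rows_def
    proof (intro CollectI conjI ballI allI impI)
      show "mat_row F k \<in> rows_over (mpolys d) n"
        using F k by (rule mat_row_in_rows_over)
      fix a v :: "nat \<Rightarrow> 'k"
      assume "\<forall>g\<in>?X. eval_row n a g v = 0"
      then have "eval_row n a (mat_row (G i) l) v = 0" if "i \<in> {1..m}" "l < n" for i l
        using that by blast
      then have "eval_mat (vec d a) (G i) *\<^sub>v vec n v = 0\<^sub>v n" if "i \<in> {1..m}" for i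
        using G[OF that] carrier[OF G[OF that]] that
        by (simp add: eval_mat_mult_vec_eq_0_iff eval_vec)
      then have "eval_mat (vec d a) F *\<^sub>v vec n v = 0\<^sub>v n"
        using vanish by simp
      then show "eval_row n a (mat_row F k) v = 0"
        using carrier[OF F] F k by (simp add: eval_mat_mult_vec_eq_0_iff eval_vec)
    qed
    then have "F \<in> I" if "semiprime_left_ideal I ?S" "G ` {1..m} \<subseteq> I" for I
      using vanishing_matrix_in_semiprime_left_ideal[OF assms(1) that F] by blast
    then show "F \<in> semiprime_left_ideal_gen ?S (G ` {1..m})"
      unfolding gen by blast
  qed
qed

end
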